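(* Let $r\in(0,1]$, $\gamma\in(0,1]$, $\lambda>0$. Then the following product representations are valid (equalities in distribution, where in each term all the involved random variables are independent): $$M_{r,\gamma,\lambda}\stackrel{d}{=}\frac{G_{r,\lambda}^{1/\gamma}\,S_{\gamma,1}}{W_1},$$ $$M_{r,\gamma,\lambda}\stackrel{d}{=}\frac{W_{\gamma}}{W'_{\gamma}}\cdot\frac{1}{Z_{r,\lambda}^{1/\gamma}}\stackrel{d}{=}W_1\cdot\frac{R_{\gamma}}{W'_1Z_{r,\lambda}^{1/\gamma}}\stackrel{d}{=}\frac{\Pi R_{\gamma}}{Z_{r,\lambda}^{1/\gamma}}\stackrel{d}{=}\frac{|X|\sqrt{2W_1}\,R_{\gamma}}{W'_1Z_{r,\lambda}^{1/\gamma}},$$ where $W_{\gamma}\stackrel{d}{=}W'_{\gamma}$, $W_1\stackrel{d}{=}W'_1$, and $\Pi$ has the Pareto distribution $\mathsf{P}(\Pi>x)=(x+1)^{-1}$, $x\ge0$.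
   Context: Notation: $\stackrel{d}{=}$ is equality of distributions. $G_{r,\lambda}$ has the gamma distribution with density $\frac{\lambda^r}{\Gamma(r)}x^{r-1}e^{-\lambda x}$, $x\ge0$ ($r,\lambda>0$). $W_\gamma$ ($\gamma>0$) has the Weibull distribution function $1-e^{-x^\gamma}$, $x\ge0$; in particular $W_1$ is standard exponential. $X$ is a standard normal random variable. $M_{r,\gamma,\lambda}=G_{r,\lambda}^{1/\gamma}/W_\gamma$ with $G_{r,\lambda}$ and $W_\gamma$ independent; equivalently it has distribution function $\big(\frac{\lambda x^{\gamma}}{1+\lambda x^{\gamma}}\big)^r$, $x\ge0$. $S_{\gamma,1}$ ($0<\gamma\le1$) has the one-sided strictly stable distribution on $[0,\infty)$ with characteristic function $\exp\{-|t|^{\gamma}\exp\{-\frac12 i\pi\gamma\,\mathrm{sign}\,t\}\}$, $t\in\mathbb{R}$; for $\gamma=1$ it is degenerate: $S_{1,1}=1$ almost surely. $R_\gamma=S_{\gamma,1}/S'_{\gamma,1}$, where $S_{\gamma,1}$ and $S'_{\gamma,1}$ are independent and identically distributed. For $\gamma\in(0,1)$ it has the density $$v_\gamma(x)=\frac{\sin(\pi\gamma)x^{\gamma-1}}{\pi[1+x^{2\gamma}+2x^\gamma\cos(\pi\gamma)]},\quad x>0;$$ for $\gamma=1$, $R_1=1$ almost surely. For $r\in(0,1)$ and $\lambda>0$, $$Z_{r,\lambda}=\frac{\lambda(G_{r,1}+G_{1-r,1})}{G_{r,1}},$$ where $G_{r,1}$ and $G_{1-r,1}$ are independent gamma random variables;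 for $r=1$, $Z_{1,\lambda}=\lambda$ (the convention $G_{0,1}=0$). *)

theory Defs
  imports "HOL-Probability.Probability" "HOL-Real_Asymp.Real_Asymp"
begin

definition gamma_law :: "real \<Rightarrow> real \<Rightarrow> real measure" where
  "gamma_law r l = density lborel
     (\<lambda>x. ennreal (if x < 0 then 0 else l powr r / Gamma r * x powr (r - 1) * exp (- l * x)))"

definition weibull_law :: "real \<Rightarrow> real measure" where
  "weibull_law \<gamma> = interval_measure (\<lambda>x. if x < 0 then 0 else 1 - exp (- (x powr \<gamma>)))"

definition pareto_law :: "real measure" where
  "pareto_law = interval_measure (\<lambda>x. if x < 0 then 0 else 1 - 1 / (x + 1))"

text \<open>The library does not construct the stable laws, so they enter as a predicate; by
  uniqueness of characteristic functions at most one \<open>\<sigma>\<close> satisfies it for a given \<open>\<gamma>\<close>.\<close>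

definition one_sided_stable_law :: "real \<Rightarrow> real measure \<Rightarrow> bool" where
  "one_sided_stable_law \<gamma> \<sigma> \<longleftrightarrow> real_distribution \<sigma> \<and> (AE x in \<sigma>. 0 \<le> x) \<and>
     (\<forall>t. char \<sigma> t = exp (- (of_real (\<bar>t\<bar> powr \<gamma>) * exp (- (1/2) * \<i> * of_real (pi * \<gamma> * sgn t)))))"

text \<open>The law of \<open>S / S'\<close> for independent \<open>S\<close>, \<open>S'\<close> with law \<open>\<sigma>\<close>.\<close>

definition ratio_law :: "real measure \<Rightarrow> real measure" where
  "ratio_law \<sigma> = distr (\<sigma> \<Otimes>\<^sub>M \<sigma>) borel (\<lambda>(s, s'). s / s')"

text \<open>The law of \<open>M = G powr (1/\<gamma>) / W\<close> for independent \<open>G\<close>, \<open>W\<close>.\<close>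

definition M_law :: "real \<Rightarrow> real \<Rightarrow> real \<Rightarrow> real measure" where
  "M_law r \<gamma> l = distr (gamma_law r l \<Otimes>\<^sub>M weibull_law \<gamma>) borel (\<lambda>(g, w). g powr (1 / \<gamma>) / w)"

text \<open>The convention \<open>G = 0\<close> for shape parameter 0 makes \<open>Z\<close> the constant \<open>l\<close> when \<open>r = 1\<close>.\<close>

definition Z_law :: "real \<Rightarrow> real \<Rightarrow> real measure" where
  "Z_law r l = (if r = 1 then return borel l
     else distr (gamma_law r 1 \<Otimes>\<^sub>M gamma_law (1 - r) 1) borel (\<lambda>(g, h). l * (g + h) / g))"

definition independent_with_laws ::
    "'a measure \<Rightarrow> ('a \<Rightarrow> real) list \<Rightarrow> real measure list \<Rightarrow> bool" where
  "independent_with_laws \<Omega> Xs \<mu>s \<longleftrightarrow>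
     prob_space \<Omega> \<and>
     list_all2 (\<lambda>X \<mu>. X \<in> borel_measurable \<Omega> \<and> distr \<Omega> borel X = \<mu>) Xs \<mu>s \<and>
     prob_space.indep_vars \<Omega> (\<lambda>_. borel) (\<lambda>i. Xs ! i) {..<length Xs}"

text \<open>\<open>interval_measure F\<close> has distribution function \<open>F\<close> only for a monotone right-continuous \<open>F\<close>
  with the right limits; the following facts confirm this for the functions used above.\<close>

lemma interval_measure_facts:
  fixes F :: "real \<Rightarrow> real"
  assumes "mono F" "continuous_on UNIV F" "\<And>x. x < 0 \<Longrightarrow> F x = 0" "(F \<longlongrightarrow> 1) at_top"
  shows "real_distribution (interval_measure F)" "cdf (interval_measure F) = F"
proof -
  have c: "continuous (at_right a) F" for a
    using assms(2) by (simp add: continuous_on_eq_continuous_at continuous_at_imp_continuous_at_within)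
  have b: "(F \<longlongrightarrow> 0) at_bot"
    by (rule tendsto_eventually) (use assms(3) eventually_at_bot_linorder[of "\<lambda>x. F x = 0"] in \<open>auto intro!: exI[of _ "-1"]\<close>)
  show "real_distribution (interval_measure F)"
    by (rule real_distribution_interval_measure) (use assms c b in \<open>auto simp: mono_def\<close>)
  show "cdf (interval_measure F) = F"
    by (rule cdf_interval_measure) (use assms c b in \<open>auto simp: mono_def\<close>)
qed

lemma weibull_law_facts:
  assumes "0 < \<gamma>"
  shows "real_distribution (weibull_law \<gamma>)"
    and "cdf (weibull_law \<gamma>) = (\<lambda>x. if x < 0 then 0 else 1 - exp (- (x powr \<gamma>)))"
proof -
  let ?F = "\<lambda>x::real. if x < 0 then 0 else 1 - exp (- (x powr \<gamma>))"
  have F: "?F = (\<lambda>x. 1 - exp (- (max 0 x powr \<gamma>)))"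
    using assms by (auto simp: fun_eq_iff max_def)
  have m: "mono ?F" unfolding F using assms by (auto intro!: monoI powr_mono2)
  have c: "continuous_on UNIV ?F" unfolding F
    using assms by (intro continuous_intros continuous_on_powr') auto
  have "((\<lambda>x::real. 1 - exp (- (x powr \<gamma>))) \<longlongrightarrow> 1) at_top"
    using assms by real_asymp
  then have l: "(?F \<longlongrightarrow> 1) at_top"
    by (rule Lim_transform_eventually) (use eventually_ge_at_top[of "0::real"] in eventually_elim, auto)
  show "real_distribution (weibull_law \<gamma>)" "cdf (weibull_law \<gamma>) = ?F"
    unfolding weibull_law_def using interval_measure_facts[OF m c _ l] by auto
qed

lemma pareto_law_facts:
  shows "real_distribution pareto_law"
    and "cdf pareto_law = (\<lambda>x. if x < 0 then 0 else 1 - 1 / (x + 1))"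
proof -
  let ?F = "\<lambda>x::real. if x < 0 then 0 else 1 - 1 / (x + 1)"
  have F: "?F = (\<lambda>x. 1 - 1 / (max 0 x + 1))"
    by (auto simp: fun_eq_iff max_def)
  have m: "mono ?F" unfolding F by (auto intro!: monoI frac_le)
  have "max 0 x + 1 \<noteq> 0" for x :: real by (simp add: max_def)
  then have c: "continuous_on UNIV ?F" unfolding F
    by (intro continuous_intros) auto
  have "((\<lambda>x::real. 1 - 1 / (x + 1)) \<longlongrightarrow> 1) at_top"
    by real_asymp
  then have l: "(?F \<longlongrightarrow> 1) at_top"
    by (rule Lim_transform_eventually) (use eventually_ge_at_top[of "0::real"] in eventually_elim, auto)
  show "real_distribution pareto_law" "cdf pareto_law = ?F"
    unfolding pareto_law_def using interval_measure_facts[OF m c _ l] by auto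
qed

end

(* For a standard exponential W and an independent Z > 0 the tail of W / Z is
   P(W / Z > x) = E[exp (- x Z)], the Laplace transform of Z. This identifies four quotients:
   W_gamma = W_1 / S (Laplace transform of the stable law), G_{r,l} = W_1 / Z_{r,l},
   Pi = W_1 / W_1', and W_{1/2} = 2 W_1 X^2, whose square root is W_1 = |X| sqrt (2 W_1).
   Multiplicative convolution of laws on the real line is associative and commutative, and reciprocals
   and powers respect it, so the asserted identities are rearrangements of these four. *)
theory Submission
  imports Defs "HOL-Complex_Analysis.Complex_Analysis"
begin

text \<open>The stable law is known only through its characteristic function, while the tail of a
  quotient needs its Laplace transform. The bridge is the integral of exp (i w x): for a law on the
  nonnegative half-line it is continuous on the closed upper half-plane and holomorphic inside; real
  w gives the characteristic function, w = i s the Laplace transform. The identity for W_{1/2} rests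
  on the law of 1 / (2 X^2), which is stable of index 1/2; its transform exp (- sqrt x) is computed
  directly from a Gaussian integral. The random variables live on five unrelated probability spaces,
  so nothing can be compared pointwise; each expression is reduced to its law, a word in convolution
  factors. Writing both Weibull variables of W_gamma / W_gamma' as W_1 / S leaves two stable
  factors, and these form R_gamma. The power 1/gamma turns G = W_1 / Z into W_gamma / Z^(1/gamma),
  which links M to these quotients.\<close>

section \<open>Laplace transform of the one-sided stable law\<close>

lemma norm_exp_diff_le:
  fixes a b :: complex
  assumes "Re a \<le> m" "Re b \<le> m"
  shows "norm (exp a - exp b) \<le> exp m * norm (a - b)"
proof (rule field_differentiable_bound[where S = "{z. Re z \<le> m}" and f' = exp])
  show "convex {z. Re z \<le> m}" by (rule convex_halfspace_Re_le)
qed (use assms in \<open>auto intro: has_field_derivative_at_within DERIV_exp\<close>)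

text \<open>Stable laws with \<gamma> < 1 have infinite mean, so the factor x produced by
  differentiating exp (i w x) cannot serve as a dominating function. Off the real axis the
  exponential decay absorbs it into a constant.\<close>

lemma exp_neg_mult_bound:
  fixes c x :: real
  assumes "0 < c"
  shows "exp (- (c * x)) * x \<le> 1 / c"
proof -
  have "c * x \<le> exp (c * x)" using exp_ge_add_one_self[of "c * x"] by linarith
  then show ?thesis using assms by (simp add: exp_minus field_simps)
qed

section \<open>Fourier transform of a law on the nonnegative half-line, extended to the upper
  half-plane\<close>

context
  fixes \<mu> :: "real measure"
  assumes \<mu>: "real_distribution \<mu>" and nonneg: "AE x in \<mu>. 0 \<le> x"
begin

interpretation real_distribution \<mu> by (fact \<mu>)

text \<open>For x \<ge> 0 and Im w \<ge> 0 the integrand has modulus at most 1, so dominated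
  convergence applies up to and including the real axis.\<close>

lemma continuous_on_fourier_upper_half_plane:
  "continuous_on {w. 0 \<le> Im w} (\<lambda>w. LINT x|\<mu>. exp (\<i> * w * complex_of_real x))"
proof (rule continuous_on_sequentiallyI)
  fix u :: "nat \<Rightarrow> complex" and a
  assume u: "\<forall>n. u n \<in> {w. 0 \<le> Im w}" and "a \<in> {w. 0 \<le> Im w}" and lim: "u \<longlonglongrightarrow> a"
  show "(\<lambda>n. LINT x|\<mu>. exp (\<i> * u n * complex_of_real x)) \<longlonglongrightarrow> (LINT x|\<mu>. exp (\<i> * a * complex_of_real x))"
  proof (rule integral_dominated_convergence[where w = "\<lambda>_. 1"])
    show "AE x in \<mu>. norm (exp (\<i> * u n * complex_of_real x)) \<le> 1" for n
      using nonneg by eventually_elim (use u in \<open>auto simp: mult_nonneg_nonneg\<close>)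
    show "AE x in \<mu>. (\<lambda>n. exp (\<i> * u n * complex_of_real x)) \<longlonglongrightarrow> exp (\<i> * a * complex_of_real x)"
      by (intro AE_I2 tendsto_intros lim)
  qed auto
qed

lemma holomorphic_on_fourier_upper_half_plane:
  "(\<lambda>w. LINT x|\<mu>. exp (\<i> * w * complex_of_real x)) holomorphic_on {w. 0 < Im w}"
proof (rule holomorphic_onI)
  fix w0 assume "w0 \<in> {w. 0 < Im w}"
  \<comment> \<open>Half the distance to the real axis: the ball of radius \<open>d\<close> stays in
    Im w \<ge> \<open>d\<close>, which gives the decay exp (- d x) uniformly on it.\<close>
  define d where "d = Im w0 / 2"
  have d: "0 < d" and Im0: "Im w0 = 2 * d" using \<open>w0 \<in> _\<close> by (auto simp: d_def)
  have Im_ball: "d \<le> Im w" if "w \<in> ball w0 d" for w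
    using that abs_Im_le_cmod[of "w0 - w"] Im0 by (auto simp: dist_norm)
  define e where "e = (\<lambda>w x. exp (\<i> * w * complex_of_real x))"
  have int: "integrable \<mu> (e w)" if "d \<le> Im w" for w
  proof (rule integrable_const_bound[where B = 1])
    show "AE x in \<mu>. norm (e w x) \<le> 1"
      using nonneg by eventually_elim (use that d in \<open>auto simp: e_def mult_nonneg_nonneg\<close>)
  qed (auto simp: e_def)
  \<comment> \<open>The mean value inequality on a half-plane of real parts bounds the difference by
    exp (- d x) x times the distance of the points. This makes the constant 1 / \<open>d\<close> a
    dominating function for all difference quotients.\<close>
  have lip: "norm (e w x - e w0 x) \<le> norm (w - w0) * (1 / d)" if w: "w \<in> ball w0 d" and x: "0 \<le> x" for w x
  proof -
    have "norm (e w x - e w0 x) \<le> exp (- (d * x)) * norm (\<i> * w * of_real x - \<i> * w0 * of_real x)"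
      unfolding e_def by (rule norm_exp_diff_le) (use Im_ball[OF w] Im0 d x in \<open>auto intro: mult_right_mono\<close>)
    also have "\<i> * w * of_real x - \<i> * w0 * of_real x = (w - w0) * (\<i> * of_real x)"
      by (simp add: algebra_simps)
    also have "exp (- (d * x)) * norm ((w - w0) * (\<i> * of_real x)) = norm (w - w0) * (exp (- (d * x)) * x)"
      using x by (simp add: norm_mult)
    also have "\<dots> \<le> norm (w - w0) * (1 / d)"
      by (intro mult_left_mono exp_neg_mult_bound d) auto
    finally show ?thesis .
  qed
  \<comment> \<open>Dominated convergence is a statement about sequences, so the limit of the
    difference quotients is tested along sequences in the ball.\<close>
  have "((\<lambda>w. ((LINT x|\<mu>. e w x) - (LINT x|\<mu>. e w0 x)) / (w - w0)) \<longlongrightarrow> (LINT x|\<mu>. \<i> * of_real x * e w0 x)) (at w0 within ball w0 d)"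
    unfolding tendsto_at_iff_sequentially
  proof safe
    fix X :: "nat \<Rightarrow> complex"
    assume X: "\<forall>i. X i \<in> ball w0 d - {w0}" and lim: "X \<longlonglongrightarrow> w0"
    have Xd: "d \<le> Im (X n)" for n using X Im_ball by blast
    have "(\<lambda>n. LINT x|\<mu>. (e (X n) x - e w0 x) / (X n - w0)) \<longlonglongrightarrow> (LINT x|\<mu>. \<i> * of_real x * e w0 x)"
    proof (rule integral_dominated_convergence[where w = "\<lambda>_. 1 / d"])
      show "AE x in \<mu>. norm ((e (X n) x - e w0 x) / (X n - w0)) \<le> 1 / d" for n
        using nonneg
      proof eventually_elim
        case (elim x)
        have "X n \<noteq> w0" using X by auto
        then show ?case
          using lip[of "X n" x] X elim by (simp add: norm_divide divide_le_eq mult.commute)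
      qed
      show "AE x in \<mu>. (\<lambda>n. (e (X n) x - e w0 x) / (X n - w0)) \<longlonglongrightarrow> \<i> * of_real x * e w0 x"
      proof (rule AE_I2)
        fix x
        have "((\<lambda>w. e w x) has_field_derivative \<i> * of_real x * e w0 x) (at w0)"
          unfolding e_def by (auto intro!: derivative_eq_intros)
        then have "((\<lambda>w. (e w x - e w0 x) / (w - w0)) \<longlongrightarrow> \<i> * of_real x * e w0 x) (at w0)"
          by (simp add: has_field_derivative_iff)
        then show "(\<lambda>n. (e (X n) x - e w0 x) / (X n - w0)) \<longlonglongrightarrow> \<i> * of_real x * e w0 x"
          using lim X unfolding tendsto_at_iff_sequentially comp_def by auto
      qed
    qed (auto simp: e_def)
    moreover have "(LINT x|\<mu>. (e (X n) x - e w0 x) / (X n - w0)) = ((LINT x|\<mu>. e (X n) x) - (LINT x|\<mu>. e w0 x)) / (X n - w0)" for n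
      using int[of "X n"] int[of w0] Xd[of n] Im0 d
      by (subst integral_divide_zero, subst Bochner_Integration.integral_diff) auto
    ultimately show "((\<lambda>w. ((LINT x|\<mu>. e w x) - (LINT x|\<mu>. e w0 x)) / (w - w0)) \<circ> X) \<longlonglongrightarrow> (LINT x|\<mu>. \<i> * of_real x * e w0 x)"
      by (simp only: comp_def)
  qed
  then have "((\<lambda>w. LINT x|\<mu>. e w x) has_field_derivative (LINT x|\<mu>. \<i> * of_real x * e w0 x)) (at w0)"
    using d by (simp add: has_field_derivative_iff at_within_open[of w0 "ball w0 d"])
  then show "(\<lambda>w. LINT x|\<mu>. exp (\<i> * w * complex_of_real x)) field_differentiable (at w0 within {w. 0 < Im w})"
    unfolding e_def field_differentiable_def by (blast intro: has_field_derivative_at_within)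
qed

end

text \<open>The functions agree only on the boundary of the domain of holomorphy, where the identity
  theorem does not apply; Schwarz reflection of the difference turns the real line into interior
  points.\<close>

lemma eq_on_upper_half_plane:
  assumes cont: "continuous_on {w. 0 \<le> Im w} f" "continuous_on {w. 0 \<le> Im w} g"
    and hol: "f holomorphic_on {w. 0 < Im w}" "g holomorphic_on {w. 0 < Im w}"
    and eq: "\<And>t. f (complex_of_real t) = g (complex_of_real t)"
    and w: "0 \<le> Im w"
  shows "f w = g w"
proof -
  define D where "D w = f w - g w" for w
  define H where "H z = (if 0 \<le> Im z then D z else cnj (D (cnj z)))" for z
  have D0: "D z = 0" if "z \<in> \<real>" for z
    using that eq by (auto simp: D_def elim!: Reals_cases)
  \<comment> \<open>The difference vanishes on the real line, so it reflects to an entire function that does too.\<close>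
  have holH: "H holomorphic_on UNIV"
    unfolding H_def
  proof (rule Schwarz_reflection)
    show "D holomorphic_on UNIV \<inter> {z. 0 < Im z}" "continuous_on (UNIV \<inter> {z. 0 \<le> Im z}) D"
      unfolding D_def using cont hol by (auto intro!: holomorphic_intros continuous_intros)
  qed (auto simp: D0)
  have lim0: "(0::complex) islimpt \<real>"
  proof -
    have "(\<lambda>n. complex_of_real (inverse (real (Suc n)))) \<longlonglongrightarrow> of_real 0"
      by (intro tendsto_of_real LIMSEQ_inverse_real_of_nat)
    then show ?thesis
      unfolding islimpt_sequential by (intro exI[of _ "\<lambda>n. complex_of_real (inverse (real (Suc n)))"]) (auto simp del: of_nat_Suc)
  qed
  have "H w = 0"
    by (rule analytic_continuation[OF holH _ _ _ _ lim0]) (auto simp: H_def D0 Complex.complex_is_Real_iff)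
  then show ?thesis using w by (simp add: H_def D_def)
qed

text \<open>The candidate for the continuation is exp (- (- i w)^\<gamma>) with the principal
  branch: Re (- i w) = Im w \<ge> 0, so the base stays off the negative real axis. At w = i s the
  base is s itself.\<close>

lemma laplace_one_sided_stable_law:
  assumes \<sigma>: "one_sided_stable_law \<gamma> \<sigma>" and "0 < \<gamma>" "\<gamma> \<le> 1" "0 \<le> s"
  shows "(LINT x|\<sigma>. exp (- (s * x))) = exp (- (s powr \<gamma>))"
proof -
  have rd: "real_distribution \<sigma>" and nn: "AE x in \<sigma>. 0 \<le> x"
    and ch: "char \<sigma> t = exp (- (of_real (\<bar>t\<bar> powr \<gamma>) * exp (- (1/2) * \<i> * of_real (pi * \<gamma> * sgn t))))" for t
    using \<sigma> by (auto simp: one_sided_stable_law_def)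
  have "(LINT x|\<sigma>. exp (\<i> * (\<i> * complex_of_real s) * complex_of_real x)) = exp (- ((- \<i> * (\<i> * complex_of_real s)) powr of_real \<gamma>))"
  proof (rule eq_on_upper_half_plane[where f = "\<lambda>w. LINT x|\<sigma>. exp (\<i> * w * complex_of_real x)"
        and g = "\<lambda>w. exp (- ((- \<i> * w) powr of_real \<gamma>))" and w = "\<i> * complex_of_real s"])
    show "continuous_on {w. 0 \<le> Im w} (\<lambda>w. exp (- ((- \<i> * w) powr of_real \<gamma>)))"
      using \<open>0 < \<gamma>\<close> by (intro continuous_intros) auto
    show "(\<lambda>w. exp (- ((- \<i> * w) powr of_real \<gamma>))) holomorphic_on {w. 0 < Im w}"
      by (intro holomorphic_intros) (auto simp: complex_nonpos_Reals_iff)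
    show "(LINT x|\<sigma>. exp (\<i> * complex_of_real t * complex_of_real x)) = exp (- ((- \<i> * complex_of_real t) powr of_real \<gamma>))" for t
    proof -
      have "(LINT x|\<sigma>. exp (\<i> * complex_of_real t * complex_of_real x)) = char \<sigma> t"
        by (simp add: char_def mult.assoc)
      moreover have "(- \<i> * complex_of_real t) powr of_real \<gamma> = of_real (\<bar>t\<bar> powr \<gamma>) * exp (- (1/2) * \<i> * of_real (pi * \<gamma> * sgn t))"
      proof (cases "t = 0")
        case False
        \<comment> \<open>For real t \<noteq> 0 the number - i t has modulus \<bar>t\<bar> and
          argument - (pi / 2) sgn t. Multiplied by \<gamma>, this argument is exactly the phase in
          the characteristic function.\<close>
        have Ln: "Ln (- \<i> * complex_of_real t) = complex_of_real (ln \<bar>t\<bar>) - \<i> * of_real (pi / 2 * sgn t)"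
        proof (rule Ln_unique)
          have "exp (- (\<i> * of_real (pi / 2 * sgn t))) = - \<i> * of_real (sgn t)"
          proof -
            have "exp (- (\<i> * of_real (pi / 2 * sgn t))) = cis (- (pi / 2 * sgn t))"
              by (simp add: cis_conv_exp)
            then show ?thesis using False by (simp add: sgn_if complex_eq_iff)
          qed
          moreover have "exp (complex_of_real (ln \<bar>t\<bar>)) = of_real \<bar>t\<bar>"
            using False by (simp add: exp_of_real)
          moreover have "\<bar>t\<bar> * sgn t = t" by (simp add: abs_mult_sgn)
          ultimately show "exp (complex_of_real (ln \<bar>t\<bar>) - \<i> * of_real (pi / 2 * sgn t)) = - \<i> * complex_of_real t"
            unfolding diff_conv_add_uminus exp_add by (metis mult.left_commute of_real_mult)
        qed (use False pi_gt_zero in \<open>auto simp: sgn_if intro: order_trans[of _ 0]\<close>)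
        have "(- \<i> * complex_of_real t) powr of_real \<gamma> = exp (of_real \<gamma> * (of_real (ln \<bar>t\<bar>) - \<i> * of_real (pi / 2 * sgn t)))"
          unfolding powr_def Ln using False by simp
        also have "\<dots> = of_real (\<bar>t\<bar> powr \<gamma>) * exp (- (1/2) * \<i> * of_real (pi * \<gamma> * sgn t))"
          using False by (simp add: powr_def exp_of_real[symmetric] exp_add[symmetric] algebra_simps)
        finally show ?thesis .
      qed (use \<open>0 < \<gamma>\<close> in auto)
      ultimately show ?thesis by (simp add: ch)
    qed
  qed (use continuous_on_fourier_upper_half_plane[OF rd nn] holomorphic_on_fourier_upper_half_plane[OF rd nn] \<open>0 \<le> s\<close> in auto)
  also have "\<i> * (\<i> * complex_of_real s) = - complex_of_real s" for s
    by (simp add: mult.assoc[symmetric])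
  then have "(\<lambda>x. exp (\<i> * (\<i> * complex_of_real s) * complex_of_real x)) = (\<lambda>x. of_real (exp (- (s * x))))"
    by (simp add: exp_of_real[symmetric])
  also have "- \<i> * (\<i> * complex_of_real s) = of_real s"
    by (simp add: mult.assoc[symmetric])
  finally have "(LINT x|\<sigma>. complex_of_real (exp (- (s * x)))) = of_real (exp (- (s powr \<gamma>)))"
    using \<open>0 \<le> s\<close> by (simp add: powr_of_real exp_of_real[symmetric])
  then show ?thesis by (simp only: integral_complex_of_real of_real_eq_iff)
qed

section \<open>Multiplicative convolution and independent products\<close>

definition mult_convolution :: "real measure \<Rightarrow> real measure \<Rightarrow> real measure" (infixr \<open>\<odot>\<close> 70) where
  "\<mu> \<odot> \<nu> = distr (\<mu> \<Otimes>\<^sub>M \<nu>) borel (\<lambda>(x, y). x * y)"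

lemma sets_mult_convolution [simp, measurable_cong]: "sets (\<mu> \<odot> \<nu>) = sets borel"
  by (simp add: mult_convolution_def)

lemma space_mult_convolution [simp]: "space (\<mu> \<odot> \<nu>) = UNIV"
  by (simp add: mult_convolution_def)

lemma real_distribution_sets: "real_distribution \<mu> \<Longrightarrow> sets \<mu> = sets borel"
  by (simp add: real_distribution_def real_distribution_axioms_def)

lemma real_distribution_distr_real:
  assumes "real_distribution \<mu>" "f \<in> borel_measurable borel"
  shows "real_distribution (distr \<mu> borel f)"
proof -
  interpret real_distribution \<mu> by fact
  show ?thesis using assms by (intro real_distribution_distr) simp
qed

lemma real_distribution_mult_convolution:
  assumes "real_distribution \<mu>" "real_distribution \<nu>"
  shows "real_distribution (\<mu> \<odot> \<nu>)"
proof -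
  interpret M: real_distribution \<mu> by fact
  interpret N: real_distribution \<nu> by fact
  interpret pair_prob_space \<mu> \<nu> ..
  note [measurable_cong] = M.events_eq_borel N.events_eq_borel
  show ?thesis unfolding mult_convolution_def by (intro P.real_distribution_distr) simp
qed

lemma nn_integral_mult_convolution:
  assumes \<mu>: "real_distribution \<mu>" and \<nu>: "real_distribution \<nu>" and [measurable]: "f \<in> borel_measurable borel"
  shows "(\<integral>\<^sup>+z. f z \<partial>(\<mu> \<odot> \<nu>)) = (\<integral>\<^sup>+x. \<integral>\<^sup>+y. f (x * y) \<partial>\<nu> \<partial>\<mu>)"
proof -
  interpret M: real_distribution \<mu> by fact
  interpret N: real_distribution \<nu> by fact
  note [measurable_cong] = M.events_eq_borel N.events_eq_borel
  show ?thesis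
    unfolding mult_convolution_def by (simp add: nn_integral_distr N.nn_integral_fst[symmetric])
qed

lemma measure_eqI_nn_integral:
  assumes "sets \<mu> = sets borel" "sets \<nu> = sets borel"
    and "\<And>f. f \<in> borel_measurable borel \<Longrightarrow> (\<integral>\<^sup>+x. f x \<partial>\<mu>) = (\<integral>\<^sup>+x. f x \<partial>\<nu>)"
  shows "\<mu> = \<nu>"
proof (rule measure_eqI)
  fix A assume "A \<in> sets \<mu>"
  then show "emeasure \<mu> A = emeasure \<nu> A"
    using assms(3)[of "indicator A"] assms(1,2) by simp
qed (use assms in simp)

lemma mult_convolution_commute:
  assumes \<mu>: "real_distribution \<mu>" and \<nu>: "real_distribution \<nu>"
  shows "\<mu> \<odot> \<nu> = \<nu> \<odot> \<mu>"
proof (rule measure_eqI_nn_integral)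
  interpret M: real_distribution \<mu> by fact
  interpret N: real_distribution \<nu> by fact
  interpret pair_prob_space \<mu> \<nu> ..
  note [measurable_cong] = M.events_eq_borel N.events_eq_borel
  fix f :: "real \<Rightarrow> ennreal" assume [measurable]: "f \<in> borel_measurable borel"
  have "(\<integral>\<^sup>+y. \<integral>\<^sup>+x. f (x * y) \<partial>\<mu> \<partial>\<nu>) = (\<integral>\<^sup>+x. \<integral>\<^sup>+y. f (x * y) \<partial>\<nu> \<partial>\<mu>)"
    by (rule Fubini') simp
  then show "(\<integral>\<^sup>+z. f z \<partial>(\<mu> \<odot> \<nu>)) = (\<integral>\<^sup>+z. f z \<partial>(\<nu> \<odot> \<mu>))"
    using \<mu> \<nu> by (simp add: nn_integral_mult_convolution mult.commute)
qed simp_all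

lemma mult_convolution_assoc:
  assumes "real_distribution \<mu>" "real_distribution \<nu>" "real_distribution \<rho>"
  shows "(\<mu> \<odot> \<nu>) \<odot> \<rho> = \<mu> \<odot> (\<nu> \<odot> \<rho>)"
proof (rule measure_eqI_nn_integral)
  interpret R: real_distribution \<rho> by fact
  note [measurable_cong] = R.events_eq_borel
  fix f :: "real \<Rightarrow> ennreal" assume [measurable]: "f \<in> borel_measurable borel"
  show "(\<integral>\<^sup>+z. f z \<partial>((\<mu> \<odot> \<nu>) \<odot> \<rho>)) = (\<integral>\<^sup>+z. f z \<partial>(\<mu> \<odot> (\<nu> \<odot> \<rho>)))"
    using assms by (simp add: nn_integral_mult_convolution real_distribution_mult_convolution mult.assoc)
qed simp_all

lemma mult_convolution_left_commute:
  assumes "real_distribution \<mu>" "real_distribution \<nu>" "real_distribution \<rho>"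
  shows "\<mu> \<odot> (\<nu> \<odot> \<rho>) = \<nu> \<odot> (\<mu> \<odot> \<rho>)"
  using assms by (metis mult_convolution_assoc mult_convolution_commute)

text \<open>Applied to \<open>inverse\<close>, real powers and \<open>sqrt\<close>. With the total
  conventions, such as \<open>inverse\<close> 0 = 0 and odd \<open>sqrt\<close>, these are
  multiplicative on the whole line, so \<open>hom\<close> can be stated for all reals.\<close>

lemma distr_mult_convolution_hom:
  assumes \<mu>: "real_distribution \<mu>" and \<nu>: "real_distribution \<nu>" and h [measurable]: "h \<in> borel_measurable borel"
    and hom: "\<And>x y. h (x * y) = h x * h y"
  shows "distr (\<mu> \<odot> \<nu>) borel h = distr \<mu> borel h \<odot> distr \<nu> borel h"
proof (rule measure_eqI_nn_integral)
  interpret M: real_distribution \<mu> by fact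
  interpret N: real_distribution \<nu> by fact
  interpret N': real_distribution "distr \<nu> borel h" by (rule real_distribution_distr_real) fact+
  note [measurable_cong] = M.events_eq_borel N.events_eq_borel
  fix f :: "real \<Rightarrow> ennreal" assume [measurable]: "f \<in> borel_measurable borel"
  show "(\<integral>\<^sup>+z. f z \<partial>distr (\<mu> \<odot> \<nu>) borel h) = (\<integral>\<^sup>+z. f z \<partial>(distr \<mu> borel h \<odot> distr \<nu> borel h))"
    by (simp add: nn_integral_mult_convolution \<mu> \<nu> real_distribution_distr_real nn_integral_distr hom)
qed simp_all

text \<open>Removes the unit mass at 1 that ends the \<open>foldr\<close> of a list of laws.\<close>

lemma mult_convolution_return:
  assumes \<mu>: "real_distribution \<mu>"
  shows "\<mu> \<odot> return borel 1 = \<mu>"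
proof (rule measure_eqI_nn_integral)
  have "real_distribution (return borel (1::real))"
    by (simp add: real_distribution_def real_distribution_axioms_def prob_space_return)
  then show "(\<integral>\<^sup>+z. f z \<partial>(\<mu> \<odot> return borel 1)) = (\<integral>\<^sup>+z. f z \<partial>\<mu>)" if "f \<in> borel_measurable borel" for f
    using that \<mu> by (simp add: nn_integral_mult_convolution nn_integral_return)
qed (simp_all add: real_distribution_sets[OF \<mu>])

section \<open>Laws of products of independent variables\<close>

lemma independent_with_laws_ConsD:
  assumes "independent_with_laws \<Omega> (X # Xs) (\<mu> # \<mu>s)"
  shows "X \<in> borel_measurable \<Omega>" "distr \<Omega> borel X = \<mu>" "real_distribution \<mu>"
    "independent_with_laws \<Omega> Xs \<mu>s"
proof -
  interpret prob_space \<Omega> using assms by (simp add: independent_with_laws_def)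
  show X: "X \<in> borel_measurable \<Omega>" and \<mu>: "distr \<Omega> borel X = \<mu>"
    using assms by (auto simp: independent_with_laws_def)
  then show "real_distribution \<mu>" using real_distribution_distr by blast
  have ind: "indep_vars (\<lambda>_. borel) (\<lambda>i. (X # Xs) ! i) {..<length (X # Xs)}"
    using assms by (simp add: independent_with_laws_def)
  \<comment> \<open>The index shift is expressed by grouping: the singleton blocks
    {\<open>Suc\<close> j} are disjoint, and the j-th group is evaluated at its only
    coordinate.\<close>
  have "indep_vars (\<lambda>_. borel) (\<lambda>j \<omega>. (\<lambda>i\<in>{Suc j}. ((X # Xs) ! i) \<omega>) (Suc j)) {..<length Xs}"
    by (rule indep_vars_compose2[OF indep_vars_restrict[OF ind, of _ "\<lambda>j. {Suc j}"], of _ "\<lambda>j f. f (Suc j)"])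
      (auto simp: disjoint_family_on_def)
  then have "indep_vars (\<lambda>_. borel) (\<lambda>i. Xs ! i) {..<length Xs}"
    by simp
  then show "independent_with_laws \<Omega> Xs \<mu>s"
    using assms by (auto simp: independent_with_laws_def)
qed

lemma distr_prod_list_independent:
  assumes "independent_with_laws \<Omega> Xs \<mu>s" "Xs \<noteq> []"
  shows "distr \<Omega> borel (\<lambda>\<omega>. \<Prod>X\<leftarrow>Xs. X \<omega>) = foldr (\<odot>) \<mu>s (return borel 1)"
  using assms
proof (induction Xs arbitrary: \<mu>s)
  case (Cons X Xs)
  obtain \<mu> \<mu>s' where \<mu>s: "\<mu>s = \<mu> # \<mu>s'"
    using Cons.prems by (auto simp: independent_with_laws_def list_all2_Cons1)
  note iwl = Cons.prems(1)[unfolded \<mu>s]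
  note D = independent_with_laws_ConsD[OF iwl]
  interpret prob_space \<Omega> using iwl by (simp add: independent_with_laws_def)
  show ?case
  proof (cases "Xs = []")
    case True
    then have "\<mu>s' = []" using iwl by (simp add: independent_with_laws_def)
    then show ?thesis using True D by (simp add: \<mu>s mult_convolution_return)
  next
    case False
    \<comment> \<open>Splitting off index 0 gives the shape that \<open>indep_vars_prod\<close>
      expects: one variable against the product of all the others.\<close>
    have "{..<length (X # Xs)} = insert 0 (Suc ` {..<length Xs})"
      by (auto simp: lessThan_Suc_eq_insert_0)
    then have "indep_vars (\<lambda>_. borel) (\<lambda>i. (X # Xs) ! i) (insert 0 (Suc ` {..<length Xs}))"
      using iwl by (simp add: independent_with_laws_def)
    from indep_vars_prod[OF _ _ this]
    have ind: "indep_var borel X borel (\<lambda>\<omega>. \<Prod>Y\<leftarrow>Xs. Y \<omega>)"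
      by (simp add: prod.reindex comp_def prod.list_conv_set_nth atLeast0LessThan)
    then have rv [measurable]: "X \<in> borel_measurable \<Omega>" "(\<lambda>\<omega>. \<Prod>Y\<leftarrow>Xs. Y \<omega>) \<in> borel_measurable \<Omega>"
      by (auto dest: indep_var_rv1 indep_var_rv2)
    have "distr \<Omega> borel (\<lambda>\<omega>. \<Prod>Y\<leftarrow>X # Xs. Y \<omega>)
        = distr (distr \<Omega> (borel \<Otimes>\<^sub>M borel) (\<lambda>\<omega>. (X \<omega>, \<Prod>Y\<leftarrow>Xs. Y \<omega>))) borel (\<lambda>(x, y). x * y)"
      by (simp add: distr_distr comp_def)
    also have "\<dots> = \<mu> \<odot> distr \<Omega> borel (\<lambda>\<omega>. \<Prod>Y\<leftarrow>Xs. Y \<omega>)"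
      using ind by (simp add: indep_var_distribution_eq D(2) mult_convolution_def)
    finally show ?thesis
      using Cons.IH[OF D(4) False] by (simp add: \<mu>s)
  qed
qed simp

lemma independent_with_laws_compose:
  assumes "independent_with_laws \<Omega> Xs \<mu>s" and len: "length fs = length Xs"
    and f: "set fs \<subseteq> borel_measurable borel"
  shows "independent_with_laws \<Omega> (map2 (\<lambda>f X \<omega>. f (X \<omega>)) fs Xs) (map2 (\<lambda>f \<mu>. distr \<mu> borel f) fs \<mu>s)"
proof -
  interpret prob_space \<Omega> using assms by (simp add: independent_with_laws_def)
  have len': "length \<mu>s = length Xs" and
    X: "\<And>i. i < length Xs \<Longrightarrow> Xs ! i \<in> borel_measurable \<Omega> \<and> distr \<Omega> borel (Xs ! i) = \<mu>s ! i" and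
    ind: "indep_vars (\<lambda>_. borel) (\<lambda>i. Xs ! i) {..<length Xs}"
    using assms(1) by (auto simp: independent_with_laws_def list_all2_conv_all_nth)
  have f': "fs ! i \<in> borel_measurable borel" if "i < length Xs" for i
    using f len that nth_mem[of i fs] by (metis subsetD)
  have "indep_vars (\<lambda>_. borel) (\<lambda>i \<omega>. (fs ! i) ((Xs ! i) \<omega>)) {..<length Xs}"
    by (rule indep_vars_compose2[OF ind]) (use f' in auto)
  then have "indep_vars (\<lambda>_. borel) (\<lambda>i. map2 (\<lambda>f X \<omega>. f (X \<omega>)) fs Xs ! i) {..<length Xs}"
    by (rule indep_vars_cong[THEN iffD1, rotated -1]) (use len in auto)
  moreover have "distr \<Omega> borel (\<lambda>\<omega>. (fs ! i) ((Xs ! i) \<omega>)) = distr (\<mu>s ! i) borel (fs ! i)" if "i < length Xs" for i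
    using X[OF that] f'[OF that] by (auto simp: distr_distr comp_def simp flip: conjunct2[OF X[OF that]])
  moreover have "(\<lambda>\<omega>. (fs ! i) ((Xs ! i) \<omega>)) \<in> borel_measurable \<Omega>" if "i < length Xs" for i
    using X[OF that] f'[OF that] by (auto intro: measurable_compose[of "Xs ! i"])
  ultimately show ?thesis
    using len len' prob_space_axioms by (auto simp: independent_with_laws_def list_all2_conv_all_nth)
qed

text \<open>The form used for all five probability spaces: \<open>fs\<close> lists the power,
  reciprocal, absolute value or root under which each variable enters the product.\<close>

lemma distr_prod_independent_compose:
  assumes "independent_with_laws \<Omega> Xs \<mu>s" "length fs = length Xs" "Xs \<noteq> []"
    and "set fs \<subseteq> borel_measurable borel"
  shows "distr \<Omega> borel (\<lambda>\<omega>. \<Prod>Y\<leftarrow>map2 (\<lambda>f X \<omega>. f (X \<omega>)) fs Xs. Y \<omega>)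
    = foldr (\<odot>) (map2 (\<lambda>f \<mu>. distr \<mu> borel f) fs \<mu>s) (return borel 1)"
proof (rule distr_prod_list_independent)
  show "map2 (\<lambda>f X \<omega>. f (X \<omega>)) fs Xs \<noteq> []"
    using assms(2,3) by (cases Xs; cases fs) auto
qed (use assms in \<open>auto intro: independent_with_laws_compose\<close>)

text \<open>Connects laws defined on a pair measure, such as \<open>M_law\<close> and
  \<open>ratio_law\<close>, with \<odot>.\<close>

lemma distr_pair_mult:
  assumes \<mu>: "real_distribution \<mu>" and \<nu>: "real_distribution \<nu>"
    and f [measurable]: "f \<in> borel_measurable borel" and h [measurable]: "h \<in> borel_measurable borel"
  shows "distr (\<mu> \<Otimes>\<^sub>M \<nu>) borel (\<lambda>(x, y). f x * h y) = distr \<mu> borel f \<odot> distr \<nu> borel h"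
proof (rule measure_eqI_nn_integral)
  interpret M: real_distribution \<mu> by fact
  interpret N: real_distribution \<nu> by fact
  interpret N': real_distribution "distr \<nu> borel h" by (rule real_distribution_distr_real) fact+
  note [measurable_cong] = M.events_eq_borel N.events_eq_borel
  fix g :: "real \<Rightarrow> ennreal" assume [measurable]: "g \<in> borel_measurable borel"
  show "(\<integral>\<^sup>+z. g z \<partial>distr (\<mu> \<Otimes>\<^sub>M \<nu>) borel (\<lambda>(x, y). f x * h y)) = (\<integral>\<^sup>+z. g z \<partial>(distr \<mu> borel f \<odot> distr \<nu> borel h))"
    by (simp add: nn_integral_mult_convolution \<mu> \<nu> real_distribution_distr_real nn_integral_distr N.nn_integral_fst[symmetric])
qed simp_all

section \<open>Quotients of an exponential variable\<close>

lemma emeasure_greaterThan_cdf: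
  assumes "real_distribution \<mu>"
  shows "emeasure \<mu> {x<..} = ennreal (1 - cdf \<mu> x)"
proof -
  interpret real_distribution \<mu> by fact
  have "{x<..} = space \<mu> - {..x}" by auto
  then have "prob {x<..} = 1 - prob {..x}"
    using prob_compl[of "{..x}"] by simp
  then show ?thesis
    by (simp add: emeasure_eq_measure cdf_def)
qed

lemma real_distribution_eqI_tail:
  assumes \<mu>: "real_distribution \<mu>" and \<nu>: "real_distribution \<nu>"
    and pos: "AE x in \<mu>. 0 < x" "AE x in \<nu>. 0 < x"
    and tail: "\<And>x. 0 < x \<Longrightarrow> emeasure \<mu> {x<..} = emeasure \<nu> {x<..}"
  shows "\<mu> = \<nu>"
proof (rule cdf_unique[OF \<mu> \<nu>], rule ext)
  fix x
  interpret M: real_distribution \<mu> by fact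
  interpret N: real_distribution \<nu> by fact
  have tail_eq: "emeasure \<mu> {x<..} = emeasure \<nu> {x<..}"
  proof (cases "0 < x")
    case False
    have "emeasure \<mu> {x<..} = 1"
      by (rule M.emeasure_eq_1_AE) (use pos(1) False in \<open>auto elim: eventually_mono\<close>)
    moreover have "emeasure \<nu> {x<..} = 1"
      by (rule N.emeasure_eq_1_AE) (use pos(2) False in \<open>auto elim: eventually_mono\<close>)
    ultimately show ?thesis by simp
  qed (rule tail)
  then show "cdf \<mu> x = cdf \<nu> x"
    using M.cdf_bounded_prob[of x] N.cdf_bounded_prob[of x]
    by (simp add: emeasure_greaterThan_cdf[OF \<mu>] emeasure_greaterThan_cdf[OF \<nu>])
qed

lemma real_distribution_AE_posI:
  assumes "real_distribution \<mu>" "emeasure \<mu> {0<..} = 1"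
  shows "AE x in \<mu>. 0 < x"
proof -
  interpret real_distribution \<mu> by fact
  show ?thesis using assms(2) AE_iff_emeasure_eq_1[of "\<lambda>x. 0 < x"] by (simp add: greaterThan_def)
qed

lemma emeasure_weibull_law_greaterThan:
  assumes "0 < \<gamma>" "0 \<le> x"
  shows "emeasure (weibull_law \<gamma>) {x<..} = ennreal (exp (- (x powr \<gamma>)))"
  using assms by (simp add: emeasure_greaterThan_cdf weibull_law_facts)

lemma AE_weibull_law_pos:
  assumes "0 < \<gamma>" shows "AE x in weibull_law \<gamma>. 0 < x"
  using assms by (intro real_distribution_AE_posI) (simp_all add: weibull_law_facts emeasure_weibull_law_greaterThan)

text \<open>On the positive half-line W^b > x means W > x^(1/b), an event of probability exp (-
  x^(a/b)).\<close>

lemma distr_weibull_law_powr: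
  assumes "0 < a" "0 < b"
  shows "distr (weibull_law a) borel (\<lambda>x. x powr b) = weibull_law (a / b)"
proof (rule real_distribution_eqI_tail)
  interpret real_distribution "weibull_law a" using assms by (simp add: weibull_law_facts)
  show "real_distribution (distr (weibull_law a) borel (\<lambda>x. x powr b))"
    by (rule real_distribution_distr) simp
  show "AE x in distr (weibull_law a) borel (\<lambda>x. x powr b). 0 < x"
    using AE_weibull_law_pos[OF \<open>0 < a\<close>] by (subst AE_distr_iff) (auto elim!: eventually_mono)
  fix x :: real assume "0 < x"
  have "emeasure (distr (weibull_law a) borel (\<lambda>x. x powr b)) {x<..} = emeasure (weibull_law a) {y. x < y powr b}"
    by (simp add: emeasure_distr vimage_def)
  also have "\<dots> = emeasure (weibull_law a) {x powr (1 / b)<..}"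
  proof (rule emeasure_eq_AE)
    show "AE y in weibull_law a. y \<in> {y. x < y powr b} \<longleftrightarrow> y \<in> {x powr (1 / b)<..}"
      using AE_weibull_law_pos[OF \<open>0 < a\<close>]
    proof eventually_elim
      case (elim y)
      have "x powr (1 / b) < y \<longleftrightarrow> (x powr (1 / b)) powr b < y powr b"
      proof
        assume "x powr (1 / b) < y"
        then show "(x powr (1 / b)) powr b < y powr b"
          by (intro powr_less_mono2 \<open>0 < b\<close>) auto
      next
        assume less: "(x powr (1 / b)) powr b < y powr b"
        show "x powr (1 / b) < y"
        proof (rule ccontr)
          assume "\<not> x powr (1 / b) < y"
          then have "y powr b \<le> (x powr (1 / b)) powr b"
            using elim \<open>0 < b\<close> by (intro powr_mono2) auto
          with less show False by simp
        qed
      qed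
      then show ?case using \<open>0 < b\<close> \<open>0 < x\<close> by (simp add: powr_powr)
    qed
  qed measurable
  also have "\<dots> = emeasure (weibull_law (a / b)) {x<..}"
    using assms \<open>0 < x\<close> by (simp add: emeasure_weibull_law_greaterThan powr_powr)
  finally show "emeasure (distr (weibull_law a) borel (\<lambda>x. x powr b)) {x<..} = emeasure (weibull_law (a / b)) {x<..}" .
qed (use assms in \<open>simp_all add: weibull_law_facts AE_weibull_law_pos\<close>)

lemma emeasure_exponential_quotient:
  assumes \<nu>: "real_distribution \<nu>" and pos: "AE z in \<nu>. 0 < z" and x: "0 \<le> x"
  shows "emeasure (weibull_law 1 \<odot> distr \<nu> borel inverse) {x<..} = (\<integral>\<^sup>+z. ennreal (exp (- (x * z))) \<partial>\<nu>)"
proof -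
  interpret N: real_distribution \<nu> by fact
  have W: "real_distribution (weibull_law 1)" by (simp add: weibull_law_facts)
  interpret W: real_distribution "weibull_law 1" by (rule W)
  note [measurable_cong] = N.events_eq_borel W.events_eq_borel
  have I: "real_distribution (distr \<nu> borel inverse)"
    by (rule real_distribution_distr_real[OF \<nu>]) simp
  \<comment> \<open>Commuting the factors puts the denominator in the outer integral, so the inner
    one is an exponential tail at x z for fixed z.\<close>
  have "emeasure (weibull_law 1 \<odot> distr \<nu> borel inverse) {x<..}
      = (\<integral>\<^sup>+y. indicator {x<..} y \<partial>(distr \<nu> borel inverse \<odot> weibull_law 1))"
    by (simp add: mult_convolution_commute[OF W I])
  also have "\<dots> = (\<integral>\<^sup>+z. \<integral>\<^sup>+w. indicator {x<..} (inverse z * w) \<partial>weibull_law 1 \<partial>\<nu>)"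
    by (subst nn_integral_mult_convolution[OF I W]) (simp_all add: nn_integral_distr del: nn_integral_indicator)
  also have "\<dots> = (\<integral>\<^sup>+z. ennreal (exp (- (x * z))) \<partial>\<nu>)"
  proof (rule nn_integral_cong_AE, use pos in eventually_elim)
    case (elim z)
    have "(\<integral>\<^sup>+w. indicator {x<..} (inverse z * w) \<partial>weibull_law 1) = (\<integral>\<^sup>+w. indicator {x * z<..} w \<partial>weibull_law 1)"
      by (intro nn_integral_cong) (use elim in \<open>auto simp: indicator_def field_simps\<close>)
    also have "\<dots> = ennreal (exp (- (x * z)))"
      using elim x by (simp add: emeasure_weibull_law_greaterThan)
    finally show ?case .
  qed
  finally show ?thesis .
qed

lemma eq_exponential_quotientI:
  assumes \<mu>: "real_distribution \<mu>" "AE x in \<mu>. 0 < x" and \<nu>: "real_distribution \<nu>" "AE z in \<nu>. 0 < z"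
    and tail: "\<And>x. 0 < x \<Longrightarrow> emeasure \<mu> {x<..} = (\<integral>\<^sup>+z. ennreal (exp (- (x * z))) \<partial>\<nu>)"
  shows "\<mu> = weibull_law 1 \<odot> distr \<nu> borel inverse"
proof (rule real_distribution_eqI_tail)
  interpret N: real_distribution \<nu> by fact
  show rd: "real_distribution (weibull_law 1 \<odot> distr \<nu> borel inverse)"
    by (intro real_distribution_mult_convolution real_distribution_distr_real \<nu>) (simp_all add: weibull_law_facts)
  \<comment> \<open>The tail formula at x = 0 integrates the constant 1, so the quotient is positive
    almost surely.\<close>
  show "AE x in weibull_law 1 \<odot> distr \<nu> borel inverse. 0 < x"
    by (rule real_distribution_AE_posI[OF rd])
      (use N.emeasure_space_1 in \<open>simp add: emeasure_exponential_quotient \<nu>\<close>)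
qed (simp_all add: \<mu> \<nu> tail emeasure_exponential_quotient)

section \<open>The stable law as a denominator\<close>

lemma nn_integral_one_sided_stable_law:
  assumes \<sigma>: "one_sided_stable_law \<gamma> \<sigma>" and \<gamma>: "0 < \<gamma>" "\<gamma> \<le> 1" and s: "0 \<le> s"
  shows "(\<integral>\<^sup>+x. ennreal (exp (- (s * x))) \<partial>\<sigma>) = ennreal (exp (- (s powr \<gamma>)))"
proof -
  interpret real_distribution \<sigma> using \<sigma> by (simp add: one_sided_stable_law_def)
  have nn: "AE x in \<sigma>. 0 \<le> x" using \<sigma> by (simp add: one_sided_stable_law_def)
  have "integrable \<sigma> (\<lambda>x. exp (- (s * x)))"
  proof (rule integrable_const_bound[where B = 1])
    show "AE x in \<sigma>. norm (exp (- (s * x))) \<le> 1"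
      using nn by eventually_elim (use s in auto)
  qed simp
  then show ?thesis
    using laplace_one_sided_stable_law[OF \<sigma> \<gamma> s] by (simp add: nn_integral_eq_integral)
qed

text \<open>An atom at 0 would survive in every Laplace value: exp (- n x) is at least 1 for x \<le>
  0, so the mass of {..0} is at most exp (- n^\<gamma>), which tends to 0.\<close>

lemma AE_one_sided_stable_law_pos:
  assumes \<sigma>: "one_sided_stable_law \<gamma> \<sigma>" and \<gamma>: "0 < \<gamma>" "\<gamma> \<le> 1"
  shows "AE x in \<sigma>. 0 < x"
proof -
  interpret real_distribution \<sigma> using \<sigma> by (simp add: one_sided_stable_law_def)
  have "prob {..0} \<le> exp (- (real n powr \<gamma>))" for n
  proof -
    have "emeasure \<sigma> {..0} = (\<integral>\<^sup>+x. indicator {..0} x \<partial>\<sigma>)" by simp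
    also have "\<dots> \<le> (\<integral>\<^sup>+x. ennreal (exp (- (real n * x))) \<partial>\<sigma>)"
      by (intro nn_integral_mono) (auto simp: indicator_def mult_nonneg_nonpos)
    also have "\<dots> = ennreal (exp (- (real n powr \<gamma>)))"
      by (rule nn_integral_one_sided_stable_law[OF \<sigma> \<gamma>]) simp
    finally show ?thesis by (simp add: emeasure_eq_measure)
  qed
  moreover have "(\<lambda>n. exp (- (real n powr \<gamma>))) \<longlonglongrightarrow> 0"
    using \<gamma> by real_asymp
  ultimately have "prob {..0} \<le> 0"
    by (intro LIMSEQ_le_const) auto
  then have "prob {..0} = 0" by (simp add: measure_le_0_iff)
  then have "AE x in \<sigma>. x \<notin> {..0}"
    by (intro AE_not_in) (simp add: null_sets_def emeasure_eq_measure)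
  then show ?thesis by eventually_elim auto
qed

lemma weibull_law_eq_exponential_quotient:
  assumes \<sigma>: "one_sided_stable_law \<gamma> \<sigma>" and \<gamma>: "0 < \<gamma>" "\<gamma> \<le> 1"
  shows "weibull_law \<gamma> = weibull_law 1 \<odot> distr \<sigma> borel inverse"
proof (rule eq_exponential_quotientI)
  show "real_distribution \<sigma>" using \<sigma> by (simp add: one_sided_stable_law_def)
  show "AE x in \<sigma>. 0 < x" by (rule AE_one_sided_stable_law_pos) fact+
  show "emeasure (weibull_law \<gamma>) {x<..} = (\<integral>\<^sup>+z. ennreal (exp (- (x * z))) \<partial>\<sigma>)" if "0 < x" for x
    using that \<gamma> by (simp add: nn_integral_one_sided_stable_law[OF \<sigma> \<gamma>] emeasure_weibull_law_greaterThan)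
qed (use \<gamma> in \<open>simp_all add: weibull_law_facts AE_weibull_law_pos\<close>)

section \<open>Gamma laws\<close>

text \<open>Substitution of c t in the Euler integral.\<close>

lemma nn_integral_Gamma_scaled:
  fixes a c :: real
  assumes "0 < a" "0 < c"
  shows "(\<integral>\<^sup>+t. ennreal (indicator {0<..} t * t powr (a - 1) * exp (- (c * t))) \<partial>lborel) = ennreal (Gamma a * c powr (- a))"
proof -
  let ?f = "\<lambda>t. ennreal (indicator {0<..} t * t powr (a - 1) * exp (- (c * t)))"
  have "ennreal (Gamma a) = (\<integral>\<^sup>+t. ennreal (indicator {0..} t * t powr (a - 1) / exp t) \<partial>lborel)"
    using \<open>0 < a\<close> by (rule Gamma_conv_nn_integral_real)
  also have "\<dots> = ennreal \<bar>c\<bar> * (\<integral>\<^sup>+t. ennreal (indicator {0..} (0 + c * t) * (0 + c * t) powr (a - 1) / exp (0 + c * t)) \<partial>lborel)"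
    using \<open>0 < c\<close> by (intro nn_integral_real_affine) auto
  also have "(\<lambda>t. ennreal (indicator {0..} (0 + c * t) * (0 + c * t) powr (a - 1) / exp (0 + c * t)))
      = (\<lambda>t. ennreal (c powr (a - 1)) * ?f t)"
  proof
    fix t :: real
    show "ennreal (indicator {0..} (0 + c * t) * (0 + c * t) powr (a - 1) / exp (0 + c * t)) = ennreal (c powr (a - 1)) * ?f t"
      using \<open>0 < c\<close> mult_pos_neg[of c t]
      by (cases t "0 :: real" rule: linorder_cases)
        (simp_all add: powr_mult exp_minus divide_inverse mult.assoc flip: ennreal_mult')
  qed
  also have "(\<integral>\<^sup>+t. ennreal (c powr (a - 1)) * ?f t \<partial>lborel) = ennreal (c powr (a - 1)) * integral\<^sup>N lborel ?f"
    by (rule nn_integral_cmult) simp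
  \<comment> \<open>In \<open>ennreal\<close> the factor c^a in front of the integral is cleared by
    multiplying both sides with c^(-a).\<close>
  finally have "ennreal (c powr (- a)) * ennreal (Gamma a) = ennreal (c powr (- a)) * (ennreal \<bar>c\<bar> * (ennreal (c powr (a - 1)) * integral\<^sup>N lborel ?f))"
    by simp
  also have "\<dots> = ennreal (c powr (- a) * (\<bar>c\<bar> * c powr (a - 1))) * integral\<^sup>N lborel ?f"
    by (simp add: ennreal_mult' mult.assoc)
  also have "c powr (- a) * (\<bar>c\<bar> * c powr (a - 1)) = 1"
    using \<open>0 < c\<close> by (simp add: powr_minus powr_diff field_simps)
  finally show ?thesis
    using assms by (simp add: ennreal_mult' mult.commute)
qed

text \<open>The density is rewritten with the indicator of the open half-line. The two forms agree
  even at x = 0, because 0 \<open>powr\<close> (r - 1) is 0.\<close>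

lemma nn_integral_gamma_law:
  assumes [measurable]: "f \<in> borel_measurable borel" and "0 < r" "0 < l"
  shows "(\<integral>\<^sup>+x. f x \<partial>gamma_law r l)
    = ennreal (l powr r / Gamma r) * (\<integral>\<^sup>+x. ennreal (indicator {0<..} x * x powr (r - 1) * exp (- (l * x))) * f x \<partial>lborel)"
proof -
  have "(\<integral>\<^sup>+x. f x \<partial>gamma_law r l)
      = (\<integral>\<^sup>+x. ennreal (if x < 0 then 0 else l powr r / Gamma r * x powr (r - 1) * exp (- l * x)) * f x \<partial>lborel)"
    unfolding gamma_law_def by (subst nn_integral_density) simp_all
  also have "(\<lambda>x. ennreal (if x < 0 then 0 else l powr r / Gamma r * x powr (r - 1) * exp (- l * x)) * f x)
      = (\<lambda>x. ennreal (l powr r / Gamma r) * (ennreal (indicator {0<..} x * x powr (r - 1) * exp (- (l * x))) * f x))"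
  proof
    fix x
    have "ennreal (if x < 0 then 0 else l powr r / Gamma r * x powr (r - 1) * exp (- l * x))
        = ennreal (l powr r / Gamma r) * ennreal (indicator {0<..} x * x powr (r - 1) * exp (- (l * x)))"
      by (subst ennreal_mult''[symmetric]) (auto simp: indicator_def not_less le_less mult.assoc)
    then show "ennreal (if x < 0 then 0 else l powr r / Gamma r * x powr (r - 1) * exp (- l * x)) * f x
        = ennreal (l powr r / Gamma r) * (ennreal (indicator {0<..} x * x powr (r - 1) * exp (- (l * x))) * f x)"
      by (simp only: mult.assoc)
  qed
  finally show ?thesis
    by (simp add: nn_integral_cmult)
qed

lemma sets_gamma_law [simp, measurable_cong]: "sets (gamma_law r l) = sets borel"
  by (simp add: gamma_law_def)

text \<open>The factor exp (- s x) only raises the rate from l to l + s, which leaves a scaled Euler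
  integral.\<close>

lemma nn_integral_exp_gamma_law:
  assumes "0 < r" "0 < l" "0 \<le> s"
  shows "(\<integral>\<^sup>+x. ennreal (exp (- (s * x))) \<partial>gamma_law r l) = ennreal ((1 + s / l) powr (- r))"
proof -
  have "(\<integral>\<^sup>+x. ennreal (exp (- (s * x))) \<partial>gamma_law r l)
      = ennreal (l powr r / Gamma r) * (\<integral>\<^sup>+x. ennreal (indicator {0<..} x * x powr (r - 1) * exp (- ((l + s) * x))) \<partial>lborel)"
  proof -
    have "ennreal (indicator {0<..} x * x powr (r - 1) * exp (- (l * x))) * ennreal (exp (- (s * x)))
        = ennreal (indicator {0<..} x * x powr (r - 1) * exp (- ((l + s) * x)))" for x
    proof -
      have "exp (- ((l + s) * x)) = exp (- (l * x)) * exp (- (s * x))"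
        by (simp add: algebra_simps flip: exp_add)
      then show ?thesis by (simp add: mult.assoc flip: ennreal_mult'')
    qed
    then show ?thesis using assms by (subst nn_integral_gamma_law) simp_all
  qed
  also have "\<dots> = ennreal (l powr r / Gamma r * (Gamma r * (l + s) powr (- r)))"
    using assms by (subst nn_integral_Gamma_scaled)
      (simp_all only: ennreal_mult'' mult_nonneg_nonneg Gamma_real_pos less_imp_le powr_ge_zero add_pos_nonneg)
  also have "l powr r / Gamma r * (Gamma r * (l + s) powr (- r)) = (1 + s / l) powr (- r)"
  proof -
    have "1 + s / l = (l + s) / l" using assms by (simp add: field_simps)
    moreover have "Gamma r \<noteq> 0"
      using Gamma_real_pos[OF \<open>0 < r\<close>] by (metis less_irrefl)
    ultimately show ?thesis
      using assms by (simp add: powr_divide powr_minus field_simps)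
  qed
  finally show ?thesis .
qed

lemma real_distribution_gamma_law:
  assumes "0 < r" "0 < l"
  shows "real_distribution (gamma_law r l)"
proof -
  have "emeasure (gamma_law r l) (space (gamma_law r l)) = 1"
    using nn_integral_exp_gamma_law[OF assms, of 0] by simp
  then show ?thesis
    by (simp add: real_distribution_def real_distribution_axioms_def prob_space.intro prob_spaceI)
qed

lemma AE_gamma_law_pos: "AE x in gamma_law r l. 0 < x"
proof -
  have "AE x in lborel. x \<noteq> (0::real)" by (rule AE_lborel_singleton)
  then show ?thesis
    unfolding gamma_law_def by (subst AE_density) (auto elim!: eventually_mono)
qed

text \<open>The substitution t = x + u / l pulls exp (- l x) out of the tail, and the powers of l
  cancel. The remaining integral of (l x + u)^(r - 1) exp (- u) is the one to which the Laplace
  transform of \<open>Z_law\<close> reduces.\<close>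

lemma emeasure_gamma_law_greaterThan:
  assumes "0 < r" "0 < l" "0 \<le> x"
  shows "emeasure (gamma_law r l) {x<..}
    = ennreal (exp (- (l * x)) / Gamma r) * (\<integral>\<^sup>+u. ennreal (indicator {0<..} u * (l * x + u) powr (r - 1) * exp (- u)) \<partial>lborel)"
proof -
  let ?f = "\<lambda>t. ennreal (indicator {0<..} t * t powr (r - 1) * exp (- (l * t))) * indicator {x<..} t"
  let ?g = "\<lambda>u. ennreal (indicator {0<..} u * (l * x + u) powr (r - 1) * exp (- u))"
  have "emeasure (gamma_law r l) {x<..} = (\<integral>\<^sup>+t. indicator {x<..} t \<partial>gamma_law r l)"
    by simp
  also have "\<dots> = ennreal (l powr r / Gamma r) * integral\<^sup>N lborel ?f"
    using assms by (intro nn_integral_gamma_law) auto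
  also have "integral\<^sup>N lborel ?f = ennreal \<bar>1 / l\<bar> * (\<integral>\<^sup>+u. ?f (x + 1 / l * u) \<partial>lborel)"
    using assms by (intro nn_integral_real_affine) auto
  also have "(\<lambda>u. ?f (x + 1 / l * u)) = (\<lambda>u. ennreal (l powr (1 - r) * exp (- (l * x))) * ?g u)"
  proof
    fix u
    show "?f (x + 1 / l * u) = ennreal (l powr (1 - r) * exp (- (l * x))) * ?g u"
    proof (cases "0 < u")
      case True
      have "x + 1 / l * u = (l * x + u) / l" using assms by (simp add: field_simps)
      then have "(x + 1 / l * u) powr (r - 1) = l powr (1 - r) * (l * x + u) powr (r - 1)"
        using powr_minus[of l "r - 1"] by (simp only: powr_divide) (simp add: divide_inverse)
      moreover have "exp (- (l * (x + 1 / l * u))) = exp (- (l * x)) * exp (- u)"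
        using assms by (simp add: distrib_left flip: exp_add)
      moreover have "x < x + 1 / l * u" "0 < x + 1 / l * u"
        using True assms by (auto simp: add_nonneg_pos)
      ultimately show ?thesis
        using True by (simp add: ac_simps flip: ennreal_mult'')
    next
      case False
      then have "\<not> x < x + 1 / l * u" using assms by (simp add: zero_less_divide_iff)
      then show ?thesis using False by simp
    qed
  qed
  also have "(\<integral>\<^sup>+u. ennreal (l powr (1 - r) * exp (- (l * x))) * ?g u \<partial>lborel)
      = ennreal (l powr (1 - r) * exp (- (l * x))) * integral\<^sup>N lborel ?g"
    by (rule nn_integral_cmult) simp
  also have "ennreal (l powr r / Gamma r) * (ennreal \<bar>1 / l\<bar> * (ennreal (l powr (1 - r) * exp (- (l * x))) * integral\<^sup>N lborel ?g))
      = ennreal (l powr r / Gamma r * (\<bar>1 / l\<bar> * (l powr (1 - r) * exp (- (l * x))))) * integral\<^sup>N lborel ?g"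
  proof -
    have "ennreal p * (ennreal q * (ennreal s * X)) = ennreal (p * (q * s)) * X" if "0 \<le> q" "0 \<le> s" for p q s X
      using that by (simp add: ennreal_mult'' mult.assoc)
    then show ?thesis by simp
  qed
  also have "l powr r / Gamma r * (\<bar>1 / l\<bar> * (l powr (1 - r) * exp (- (l * x)))) = exp (- (l * x)) / Gamma r"
    using assms by (simp add: powr_diff field_simps)
  finally show ?thesis .
qed

lemma emeasure_gamma_law_1_greaterThan:
  assumes "0 < l" "0 \<le> x"
  shows "emeasure (gamma_law 1 l) {x<..} = ennreal (exp (- (l * x)))"
proof -
  have "(\<integral>\<^sup>+u. ennreal (indicator {0<..} u * (l * x + u) powr (1 - 1) * exp (- u)) \<partial>lborel)
      = (\<integral>\<^sup>+u. ennreal (indicator {0<..} u * u powr (1 - 1) * exp (- (1 * u))) \<partial>lborel)"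
    using assms by (intro nn_integral_cong) (auto simp: indicator_def add_nonneg_eq_0_iff)
  also have "\<dots> = 1"
    by (subst nn_integral_Gamma_scaled) simp_all
  finally show ?thesis
    using emeasure_gamma_law_greaterThan[of 1 l x] assms by simp
qed

lemma weibull_law_1: "weibull_law 1 = gamma_law 1 1"
  by (rule real_distribution_eqI_tail)
    (simp_all add: weibull_law_facts real_distribution_gamma_law AE_weibull_law_pos AE_gamma_law_pos
      emeasure_weibull_law_greaterThan emeasure_gamma_law_1_greaterThan)

text \<open>The Laplace transform 1 / (1 + x) of the standard exponential law is the Pareto
  tail.\<close>

lemma pareto_law_eq_exponential_quotient:
  "pareto_law = weibull_law 1 \<odot> distr (weibull_law 1) borel inverse"
proof (rule eq_exponential_quotientI)
  show rd: "real_distribution pareto_law" by (rule pareto_law_facts)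
  show "AE x in pareto_law. 0 < x"
    by (rule real_distribution_AE_posI[OF rd]) (simp add: emeasure_greaterThan_cdf pareto_law_facts)
  show "emeasure pareto_law {x<..} = (\<integral>\<^sup>+z. ennreal (exp (- (x * z))) \<partial>weibull_law 1)" if "0 < x" for x
    using that nn_integral_exp_gamma_law[of 1 1 x]
    by (simp add: emeasure_greaterThan_cdf pareto_law_facts weibull_law_1 powr_minus inverse_eq_divide add.commute)
qed (simp_all add: weibull_law_facts AE_weibull_law_pos)

text \<open>With y = l x, the exponent is x Z = y + (y / G) H, where G and H have shapes r and 1 -
  r. Given G = g, integrating over H yields exp (- y) (1 + y / g)^(r - 1). The power merges with
  g^(r - 1) from the density of G into (y + g)^(r - 1), which is the integrand of the gamma tail.
  The two shapes sum to 1 precisely so that both exponents are r - 1.\<close>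

lemma gamma_law_eq_exponential_quotient:
  assumes r: "0 < r" "r \<le> 1" and l: "0 < l"
  shows "real_distribution (Z_law r l)" "gamma_law r l = weibull_law 1 \<odot> distr (Z_law r l) borel inverse"
proof -
  \<comment> \<open>The three facts are bundled so that the degenerate case r = 1, where Z is the
    constant l, is split off once.\<close>
  have "real_distribution (Z_law r l) \<and> (AE z in Z_law r l. 0 < z) \<and>
    (\<forall>x>0. emeasure (gamma_law r l) {x<..} = (\<integral>\<^sup>+z. ennreal (exp (- (x * z))) \<partial>Z_law r l))"
  proof (cases "r = 1")
    case True
    then have "Z_law r l = return borel l" by (simp add: Z_law_def)
    moreover have "real_distribution (return borel l)"
      by (simp add: real_distribution_def real_distribution_axioms_def prob_space_return)
    moreover have "AE z in return borel l. 0 < z"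
      using l by (subst AE_return) auto
    moreover have "emeasure (gamma_law r l) {x<..} = (\<integral>\<^sup>+z. ennreal (exp (- (x * z))) \<partial>return borel l)" if "0 < x" for x
      using that l True by (simp add: nn_integral_return emeasure_gamma_law_1_greaterThan mult.commute)
    ultimately show ?thesis by metis
  next
    case False
    then have r1: "0 < 1 - r" using r by simp
    have Z: "Z_law r l = distr (gamma_law r 1 \<Otimes>\<^sub>M gamma_law (1 - r) 1) borel (\<lambda>(g, h). l * (g + h) / g)"
      using False by (simp add: Z_law_def)
    interpret G: real_distribution "gamma_law r 1" using r by (simp add: real_distribution_gamma_law)
    interpret H: real_distribution "gamma_law (1 - r) 1" using r1 by (simp add: real_distribution_gamma_law)
    interpret pair_prob_space "gamma_law r 1" "gamma_law (1 - r) 1" ..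
    have "AE p in gamma_law r 1 \<Otimes>\<^sub>M gamma_law (1 - r) 1. case p of (g, h) \<Rightarrow> 0 < l * (g + h) / g"
    proof (rule AE_pair_measure)
      show "AE g in gamma_law r 1. AE h in gamma_law (1 - r) 1. case (g, h) of (g, h) \<Rightarrow> 0 < l * (g + h) / g"
        using AE_gamma_law_pos
      proof eventually_elim
        case (elim g)
        show ?case
          using AE_gamma_law_pos by eventually_elim (use elim l in auto)
      qed
    qed measurable
    then have pos: "AE z in Z_law r l. 0 < z"
      unfolding Z by (subst AE_distr_iff) (auto simp: split_beta')
    have "emeasure (gamma_law r l) {x<..} = (\<integral>\<^sup>+z. ennreal (exp (- (x * z))) \<partial>Z_law r l)" if x: "0 < x" for x
    proof -
      let ?y = "l * x"
      have y: "0 < ?y" using x l by simp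
      have "(\<integral>\<^sup>+z. ennreal (exp (- (x * z))) \<partial>Z_law r l)
          = (\<integral>\<^sup>+g. \<integral>\<^sup>+h. ennreal (exp (- (x * (l * (g + h) / g)))) \<partial>gamma_law (1 - r) 1 \<partial>gamma_law r 1)"
        unfolding Z by (simp add: nn_integral_distr H.nn_integral_fst[symmetric])
      also have "\<dots> = (\<integral>\<^sup>+g. ennreal (exp (- ?y) * (1 + ?y / g) powr (r - 1)) \<partial>gamma_law r 1)"
      proof (rule nn_integral_cong_AE, use AE_gamma_law_pos in eventually_elim)
        case (elim g)
        have "(\<integral>\<^sup>+h. ennreal (exp (- (x * (l * (g + h) / g)))) \<partial>gamma_law (1 - r) 1)
            = (\<integral>\<^sup>+h. ennreal (exp (- ?y)) * ennreal (exp (- (?y / g * h))) \<partial>gamma_law (1 - r) 1)"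
          by (intro nn_integral_cong) (use elim in \<open>simp add: field_simps flip: ennreal_mult'' exp_add\<close>)
        also have "\<dots> = ennreal (exp (- ?y)) * (\<integral>\<^sup>+h. ennreal (exp (- (?y / g * h))) \<partial>gamma_law (1 - r) 1)"
          by (rule nn_integral_cmult) simp
        also have "\<dots> = ennreal (exp (- ?y) * (1 + ?y / g) powr (r - 1))"
          using elim y r1 by (subst nn_integral_exp_gamma_law) (simp_all add: ennreal_mult')
        finally show ?case .
      qed
      also have "\<dots> = ennreal (1 / Gamma r) *
          (\<integral>\<^sup>+g. ennreal (indicator {0<..} g * g powr (r - 1) * exp (- (1 * g))) * ennreal (exp (- ?y) * (1 + ?y / g) powr (r - 1)) \<partial>lborel)"
        using r by (subst nn_integral_gamma_law) simp_all
      also have "(\<lambda>g. ennreal (indicator {0<..} g * g powr (r - 1) * exp (- (1 * g))) * ennreal (exp (- ?y) * (1 + ?y / g) powr (r - 1)))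
          = (\<lambda>g. ennreal (exp (- ?y)) * ennreal (indicator {0<..} g * (?y + g) powr (r - 1) * exp (- g)))"
      proof
        fix g :: real
        have "g powr (r - 1) * (1 + ?y / g) powr (r - 1) = (?y + g) powr (r - 1)" if "0 < g"
        proof -
          have "g * (1 + ?y / g) = ?y + g" using that by (simp add: field_simps)
          then show ?thesis by (simp only: flip: powr_mult)
        qed
        then have "(indicator {0<..} g * g powr (r - 1) * exp (- (1 * g))) * (exp (- ?y) * (1 + ?y / g) powr (r - 1))
            = exp (- ?y) * (indicator {0<..} g * (?y + g) powr (r - 1) * exp (- g))"
          by (auto simp: indicator_def)
        moreover have nonneg: "0 \<le> exp (- ?y) * (1 + ?y / g) powr (r - 1)" "0 \<le> indicator {0<..} g * (?y + g) powr (r - 1) * exp (- g)"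
          by simp_all
        ultimately show "ennreal (indicator {0<..} g * g powr (r - 1) * exp (- (1 * g))) * ennreal (exp (- ?y) * (1 + ?y / g) powr (r - 1))
            = ennreal (exp (- ?y)) * ennreal (indicator {0<..} g * (?y + g) powr (r - 1) * exp (- g))"
          by (simp only: ennreal_mult''[OF nonneg(1), symmetric] ennreal_mult''[OF nonneg(2), symmetric])
      qed
      also have "ennreal (1 / Gamma r) * (\<integral>\<^sup>+g. ennreal (exp (- ?y)) * ennreal (indicator {0<..} g * (?y + g) powr (r - 1) * exp (- g)) \<partial>lborel)
          = emeasure (gamma_law r l) {x<..}"
      proof -
        have "ennreal (1 / p) * (ennreal q * X) = ennreal (q / p) * X" if "0 \<le> q" for p q X
          using that by (simp add: mult.assoc[symmetric] ennreal_mult''[symmetric])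
        then show ?thesis
          using r l x by (subst nn_integral_cmult, simp, subst emeasure_gamma_law_greaterThan) simp_all
      qed
      finally show ?thesis by simp
    qed
    moreover have "real_distribution (Z_law r l)"
      unfolding Z by (intro P.real_distribution_distr) simp
    ultimately show ?thesis using pos by blast
  qed
  then show "real_distribution (Z_law r l)" "gamma_law r l = weibull_law 1 \<odot> distr (Z_law r l) borel inverse"
    using r l by (auto intro!: eq_exponential_quotientI real_distribution_gamma_law AE_gamma_law_pos)
qed

section \<open>The normal law\<close>

text \<open>The Cauchy-Schloemilch substitution u = y - a / y maps the positive half-line onto the
  real line and turns the integrand into exp (- a) times the normal density in u. The Jacobian of
  its inverse is (1 + \<open>h\<close> u) / 2 with \<open>h\<close> odd, so only the constant 1/2
  contributes.\<close>

lemma gaussian_reciprocal_integral: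
  fixes a :: real
  assumes a: "0 < a"
  defines "f \<equiv> \<lambda>y::real. std_normal_density y * exp (- (a\<^sup>2 / (2 * y\<^sup>2)))"
  shows "set_integrable lborel {0<..} f" "(LINT y:{0<..}|lborel. f y) = exp (- a) / 2"
proof -
  \<comment> \<open>\<open>g\<close> inverts \<open>y \<mapsto> y - a / y\<close>, and \<open>(y\<^sup>2 + a\<^sup>2 / y\<^sup>2) / 2 = (y - a / y)\<^sup>2 / 2 + a\<close>.\<close>
  define g where "g u = (u + sqrt (u\<^sup>2 + 4 * a)) / 2" for u
  define h where "h u = u / sqrt (u\<^sup>2 + 4 * a)" for u
  have pos: "0 < u\<^sup>2 + 4 * a" for u :: real
    using a by (simp add: add_nonneg_pos)
  have abs_less: "\<bar>u\<bar> < sqrt (u\<^sup>2 + 4 * a)" for u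
    using a by (metis less_add_same_cancel1 mult_pos_pos real_sqrt_abs real_sqrt_less_iff zero_less_numeral)
  have g_pos: "0 < g u" for u
    using abs_less[of u] by (simp add: g_def)
  have h_le: "\<bar>h u\<bar> \<le> 1" for u
    using abs_less[of u] pos[of u] by (simp add: h_def)
  have deriv: "DERIV g u :> (1 + h u) / 2" for u
    unfolding g_def h_def using pos[of u]
    by (auto intro!: derivative_eq_intros simp: field_simps)
  have fg: "f (g u) = exp (- a) * std_normal_density u" for u
  proof -
    \<comment> \<open>\<open>g\<close> u is the positive root of y^2 - u y - a = 0.\<close>
    have "(sqrt (u\<^sup>2 + 4 * a))\<^sup>2 = u\<^sup>2 + 4 * a" using pos[of u] by simp
    then have "g u * (g u - u) = a"
      by (simp add: g_def field_simps power2_eq_square)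
    then have q: "a / g u = g u - u" using g_pos[of u] by (simp add: field_simps)
    have "(g u)\<^sup>2 / 2 + a\<^sup>2 / (2 * (g u)\<^sup>2) = ((g u - a / g u)\<^sup>2) / 2 + a"
      using g_pos[of u] by (simp add: field_simps power2_eq_square)
    also have "g u - a / g u = u" using q by simp
    finally show ?thesis
      by (simp add: f_def std_normal_density_def algebra_simps flip: exp_add)
  qed
  have int_n: "integrable lborel std_normal_density"
    by simp
  have [measurable]: "h \<in> borel_measurable borel" unfolding h_def by measurable
  have int_h: "integrable lborel (\<lambda>u. std_normal_density u * h u)"
    by (rule Bochner_Integration.integrable_bound[OF int_n])
      (use h_le in \<open>auto simp: abs_mult intro!: AE_I2 mult_left_le\<close>)
  have int_fg: "integrable lborel (\<lambda>u. f (g u) * ((1 + h u) / 2))"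
  proof -
    have "(\<lambda>u. f (g u) * ((1 + h u) / 2)) = (\<lambda>u. exp (- a) / 2 * std_normal_density u + exp (- a) / 2 * (std_normal_density u * h u))"
      by (auto simp: fg field_simps)
    then show ?thesis using int_n int_h by simp
  qed
  \<comment> \<open>Since \<bar>\<open>h\<close>\<bar> \<le> 1, this integral converges; reflection
    then makes it equal to its own negative.\<close>
  have odd: "(LINT u|lborel. std_normal_density u * h u) = 0"
  proof -
    have "(LINT u|lborel. std_normal_density u * h u) = (LINT u|lborel. std_normal_density (- u) * h (- u))"
      using lborel_integral_real_affine[of "-1" "\<lambda>u. std_normal_density u * h u" 0] by simp
    also have "\<dots> = - (LINT u|lborel. std_normal_density u * h u)"
      by (simp add: h_def std_normal_density_def)
    finally show ?thesis by simp
  qed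
  have total: "(LINT u|lborel. f (g u) * ((1 + h u) / 2)) = exp (- a) / 2"
  proof -
    have "(LINT u|lborel. f (g u) * ((1 + h u) / 2))
        = (LINT u|lborel. exp (- a) / 2 * std_normal_density u + exp (- a) / 2 * (std_normal_density u * h u))"
      by (simp add: fg algebra_simps add_divide_distrib)
    also have "\<dots> = exp (- a) / 2 * (LINT u|lborel. std_normal_density u) + exp (- a) / 2 * (LINT u|lborel. std_normal_density u * h u)"
      using int_n int_h by (simp del: integral_mult_right_zero add: integral_mult_right)
    also have "(LINT u|lborel. std_normal_density u) = 1"
      by simp
    finally show ?thesis using odd by simp
  qed
  have eint: "einterval 0 \<infinity> = {0::real<..}" "einterval (-\<infinity>) \<infinity> = (UNIV :: real set)"
    by (auto simp: einterval_def zero_ereal_def)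
  have lim_bot: "((ereal \<circ> g \<circ> real_of_ereal) \<longlongrightarrow> 0) (at_right (-\<infinity>))"
  proof -
    have "(g \<longlongrightarrow> 0) at_bot" unfolding g_def using a by real_asymp
    then show ?thesis by (simp add: ereal_tendsto_simps1 ereal_tendsto_simps2 zero_ereal_def)
  qed
  have lim_top: "((ereal \<circ> g \<circ> real_of_ereal) \<longlongrightarrow> \<infinity>) (at_left \<infinity>)"
  proof -
    have "filterlim g at_top at_top" unfolding g_def using a by real_asymp
    then show ?thesis by (simp add: ereal_tendsto_simps1 ereal_tendsto_simps2 tendsto_PInfty_eq_at_top)
  qed
  have contf: "isCont f (g u)" for u
    unfolding f_def std_normal_density_def using g_pos[of u] by (intro continuous_intros) auto
  have conth: "isCont (\<lambda>u. (1 + h u) / 2) u" for u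
    unfolding h_def using pos[of u] by (intro continuous_intros) auto
  have h_nonneg: "0 \<le> (1 + h u) / 2" for u
    using h_le[of u] by auto
  have f_nonneg: "0 \<le> f y" for y by (simp add: f_def)
  \<comment> \<open>The substitution rule for nonnegative integrands also delivers integrability of
    \<open>f\<close>, inherited from the integrand in u.\<close>
  have "set_integrable lborel (einterval 0 \<infinity>) f" "(LBINT x=0..\<infinity>. f x) = (LBINT x=-\<infinity>..\<infinity>. f (g x) * ((1 + h x) / 2))"
    using interval_integral_substitution_nonneg[of "-\<infinity>" \<infinity> g "\<lambda>u. (1 + h u) / 2" f 0 \<infinity>]
      deriv contf conth f_nonneg h_nonneg lim_bot lim_top int_fg
    by (simp_all add: eint set_integrable_def)
  then show "set_integrable lborel {0<..} f" "(LINT y:{0<..}|lborel. f y) = exp (- a) / 2"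
    using total by (simp_all add: eint interval_lebesgue_integral_def set_lebesgue_integral_def)
qed

text \<open>The integrand is even and the origin is a null set, so the value is twice the half-line
  integral. It is the Laplace transform of 1 / (2 X^2) at a^2.\<close>

lemma nn_integral_std_normal_reciprocal:
  assumes a: "0 < a"
  shows "(\<integral>\<^sup>+y. ennreal (std_normal_density y * exp (- (a\<^sup>2 / (2 * y\<^sup>2)))) \<partial>lborel) = ennreal (exp (- a))"
proof -
  let ?f = "\<lambda>y. std_normal_density y * exp (- (a\<^sup>2 / (2 * y\<^sup>2)))"
  have half: "(\<integral>\<^sup>+y. ennreal (indicator {0<..} y * ?f y) \<partial>lborel) = ennreal (exp (- a) / 2)"
    using gaussian_reciprocal_integral[OF a]
    by (subst nn_integral_eq_integral) (auto simp: set_integrable_def set_lebesgue_integral_def)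
  have "(\<integral>\<^sup>+y. ennreal (indicator {..<0} y * ?f y) \<partial>lborel) = (\<integral>\<^sup>+y. ennreal (indicator {..<0} (- y) * ?f (- y)) \<partial>lborel)"
    using nn_integral_real_affine[of "\<lambda>y. ennreal (indicator {..<0} y * ?f y)" "-1" 0] by simp
  also have "(\<lambda>y. ennreal (indicator {..<0} (- y) * ?f (- y))) = (\<lambda>y. ennreal (indicator {0<..} y * ?f y))"
    by (auto simp: indicator_def std_normal_density_def)
  finally have half': "(\<integral>\<^sup>+y. ennreal (indicator {..<0} y * ?f y) \<partial>lborel) = ennreal (exp (- a) / 2)"
    by (simp add: half)
  have "AE y in lborel. y \<noteq> (0::real)" by (rule AE_lborel_singleton)
  then have "(\<integral>\<^sup>+y. ennreal (?f y) \<partial>lborel) = (\<integral>\<^sup>+y. ennreal (indicator {0<..} y * ?f y) + ennreal (indicator {..<0} y * ?f y) \<partial>lborel)"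
    by (intro nn_integral_cong_AE) (auto simp: indicator_def elim!: eventually_mono)
  also have "\<dots> = ennreal (exp (- a) / 2) + ennreal (exp (- a) / 2)"
    by (simp add: nn_integral_add half half')
  finally show ?thesis by (simp flip: ennreal_plus)
qed

lemma weibull_law_half_eq_exponential_quotient:
  "weibull_law (1 / 2) = weibull_law 1 \<odot>
    distr (distr (density lborel std_normal_density) borel (\<lambda>x. inverse (2 * x\<^sup>2))) borel inverse"
proof (rule eq_exponential_quotientI)
  have N: "real_distribution (density lborel std_normal_density)"
    by (simp add: real_distribution_def real_distribution_axioms_def prob_space_normal_density)
  show "real_distribution (distr (density lborel std_normal_density) borel (\<lambda>x. inverse (2 * x\<^sup>2)))"
    by (rule real_distribution_distr_real[OF N]) simp
  have "AE y in lborel. y \<noteq> (0::real)" by (rule AE_lborel_singleton)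
  then show "AE z in distr (density lborel std_normal_density) borel (\<lambda>x. inverse (2 * x\<^sup>2)). 0 < z"
    by (subst AE_distr_iff) (auto simp: AE_density elim!: eventually_mono)
  fix x :: real assume x: "0 < x"
  have "(\<integral>\<^sup>+z. ennreal (exp (- (x * z))) \<partial>distr (density lborel std_normal_density) borel (\<lambda>x. inverse (2 * x\<^sup>2)))
      = (\<integral>\<^sup>+y. ennreal (std_normal_density y) * ennreal (exp (- (x * inverse (2 * y\<^sup>2)))) \<partial>lborel)"
    by (subst nn_integral_distr, simp, simp, subst nn_integral_density) auto
  also have "\<dots> = (\<integral>\<^sup>+y. ennreal (std_normal_density y * exp (- ((sqrt x)\<^sup>2 / (2 * y\<^sup>2)))) \<partial>lborel)"
  proof -
    have "(sqrt x)\<^sup>2 = x" using x by simp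
    then show ?thesis by (simp only: ennreal_mult''[OF exp_ge_zero, symmetric] divide_inverse)
  qed
  also have "\<dots> = ennreal (exp (- (sqrt x)))"
    using x by (intro nn_integral_std_normal_reciprocal) simp
  finally show "emeasure (weibull_law (1 / 2)) {x<..} = (\<integral>\<^sup>+z. ennreal (exp (- (x * z)))
      \<partial>distr (density lborel std_normal_density) borel (\<lambda>x. inverse (2 * x\<^sup>2)))"
    using x by (simp add: emeasure_weibull_law_greaterThan powr_half_sqrt)
qed (simp_all add: weibull_law_facts AE_weibull_law_pos)

section \<open>Product representations\<close>

lemma exponential_eq_normal_product:
  "distr (density lborel std_normal_density) borel abs \<odot> distr (weibull_law 1) borel (\<lambda>w. sqrt (2 * w)) = weibull_law 1"
proof -
  let ?N = "density lborel std_normal_density" and ?E = "weibull_law 1"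
  have N: "real_distribution ?N"
    by (simp add: real_distribution_def real_distribution_axioms_def prob_space_normal_density)
  have E: "real_distribution ?E" by (simp add: weibull_law_facts)
  have "?E = distr (weibull_law (1 / 2)) borel (\<lambda>x. x powr (1 / 2))"
    by (simp add: distr_weibull_law_powr)
  \<comment> \<open>\<open>sqrt\<close> and \<open>x powr (1 / 2)\<close> differ for negative \<open>x\<close>.\<close>
  also have "\<dots> = distr (weibull_law (1 / 2)) borel sqrt"
  proof (rule distr_cong_AE)
    show "AE x in weibull_law (1 / 2). x powr (1 / 2) = sqrt x"
      using AE_weibull_law_pos[of "1 / 2"] by (auto simp: powr_half_sqrt elim!: eventually_mono)
  qed (auto simp: real_distribution.events_eq_borel[OF weibull_law_facts(1)] cong: measurable_cong_sets)
  also have "\<dots> = distr ?E borel sqrt \<odot>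
      distr (distr (distr ?N borel (\<lambda>x. inverse (2 * x\<^sup>2))) borel inverse) borel sqrt"
    unfolding weibull_law_half_eq_exponential_quotient
    by (intro distr_mult_convolution_hom E real_distribution_distr_real N) (auto simp: real_sqrt_mult)
  also have "distr (distr (distr ?N borel (\<lambda>x. inverse (2 * x\<^sup>2))) borel inverse) borel sqrt
      = distr ?N borel (\<lambda>x. sqrt (2 * x\<^sup>2))"
    by (subst distr_distr, simp, simp)+ (simp only: comp_def inverse_inverse_eq)
  also have "distr ?E borel sqrt \<odot> distr ?N borel (\<lambda>x. sqrt (2 * x\<^sup>2)) = distr ?N borel (\<lambda>x. sqrt (2 * x\<^sup>2)) \<odot> distr ?E borel sqrt"
    by (intro mult_convolution_commute real_distribution_distr_real E N) simp_all
  \<comment> \<open>Recombining both factors over the pair measure allows the constant 2 to move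
    from the normal root to the exponential one: sqrt (2 x^2) sqrt w = \<bar>x\<bar> sqrt (2
    w).\<close>
  also have "\<dots> = distr (?N \<Otimes>\<^sub>M ?E) borel (\<lambda>(x, w). sqrt (2 * x\<^sup>2) * sqrt w)"
    by (intro distr_pair_mult[symmetric] E N) simp_all
  also have "(\<lambda>(x, w). sqrt (2 * x\<^sup>2) * sqrt w) = (\<lambda>(x :: real, w). \<bar>x\<bar> * sqrt (2 * w))"
    by (auto simp: real_sqrt_mult)
  also have "distr (?N \<Otimes>\<^sub>M ?E) borel (\<lambda>(x, w). \<bar>x\<bar> * sqrt (2 * w)) = distr ?N borel abs \<odot> distr ?E borel (\<lambda>w. sqrt (2 * w))"
    by (intro distr_pair_mult E N) simp_all
  finally show ?thesis by simp
qed

text \<open>All the laws share one normal form, the convolution of \<open>E\<close>,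
  \<open>iE\<close>, \<open>\<sigma>\<close>, \<open>iS\<close> and \<open>q\<close>, where
  \<open>q\<close> is the law of Z^(-1/\<gamma>); in the last expression \<open>E\<close> is split
  as \<open>aX \<odot> sE\<close>.\<close>

theorem theorem4:
  fixes r \<gamma> l :: real and \<sigma> :: "real measure"
    and \<Omega>1 :: "'a measure" and \<Omega>2 :: "'b measure" and \<Omega>3 :: "'c measure"
    and \<Omega>4 :: "'d measure" and \<Omega>5 :: "'e measure"
  assumes "0 < r" "r \<le> 1" "0 < \<gamma>" "\<gamma> \<le> 1" "0 < l"
    and "one_sided_stable_law \<gamma> \<sigma>"
    and "independent_with_laws \<Omega>1 [G1, S1, W1]
           [gamma_law r l, \<sigma>, weibull_law 1]"
    and "independent_with_laws \<Omega>2 [W2, W2', Z2]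
           [weibull_law \<gamma>, weibull_law \<gamma>, Z_law r l]"
    and "independent_with_laws \<Omega>3 [W3, R3, W3', Z3]
           [weibull_law 1, ratio_law \<sigma>, weibull_law 1, Z_law r l]"
    and "independent_with_laws \<Omega>4 [P4, R4, Z4]
           [pareto_law, ratio_law \<sigma>, Z_law r l]"
    and "independent_with_laws \<Omega>5 [X5, W5, R5, W5', Z5]
           [density lborel std_normal_density, weibull_law 1, ratio_law \<sigma>, weibull_law 1, Z_law r l]"
  shows "M_law r \<gamma> l = distr \<Omega>1 borel (\<lambda>\<omega>. G1 \<omega> powr (1 / \<gamma>) * S1 \<omega> / W1 \<omega>)
    \<and> M_law r \<gamma> l = distr \<Omega>2 borel (\<lambda>\<omega>. W2 \<omega> / W2' \<omega> * (1 / Z2 \<omega> powr (1 / \<gamma>)))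
    \<and> distr \<Omega>2 borel (\<lambda>\<omega>. W2 \<omega> / W2' \<omega> * (1 / Z2 \<omega> powr (1 / \<gamma>)))
       = distr \<Omega>3 borel (\<lambda>\<omega>. W3 \<omega> * (R3 \<omega> / (W3' \<omega> * Z3 \<omega> powr (1 / \<gamma>))))
    \<and> distr \<Omega>3 borel (\<lambda>\<omega>. W3 \<omega> * (R3 \<omega> / (W3' \<omega> * Z3 \<omega> powr (1 / \<gamma>))))
       = distr \<Omega>4 borel (\<lambda>\<omega>. P4 \<omega> * R4 \<omega> / Z4 \<omega> powr (1 / \<gamma>))
    \<and> distr \<Omega>4 borel (\<lambda>\<omega>. P4 \<omega> * R4 \<omega> / Z4 \<omega> powr (1 / \<gamma>))
       = distr \<Omega>5 borel (\<lambda>\<omega>. \<bar>X5 \<omega>\<bar> * sqrt (2 * W5 \<omega>) * R5 \<omega> / (W5' \<omega> * Z5 \<omega> powr (1 / \<gamma>)))"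
proof -
  define E where "E = weibull_law 1"
  define iE where "iE = distr E borel inverse"
  define iS where "iS = distr \<sigma> borel inverse"
  define pG where "pG = distr (gamma_law r l) borel (\<lambda>x. x powr (1 / \<gamma>))"
  define q where "q = distr (Z_law r l) borel (\<lambda>z. inverse (z powr (1 / \<gamma>)))"
  define aX where "aX = distr (density lborel std_normal_density) borel abs"
  define sE where "sE = distr E borel (\<lambda>w. sqrt (2 * w))"
  have rS: "real_distribution \<sigma>" using assms(6) by (simp add: one_sided_stable_law_def)
  have rE: "real_distribution E" by (simp add: E_def weibull_law_facts)
  have rW: "real_distribution (weibull_law \<gamma>)" using assms(3) by (rule weibull_law_facts)
  have rZ: "real_distribution (Z_law r l)" using assms(1,2,5) by (rule gamma_law_eq_exponential_quotient)
  have rG: "real_distribution (gamma_law r l)" using assms(1,5) by (rule real_distribution_gamma_law)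
  have rN: "real_distribution (density lborel std_normal_density)"
    by (simp add: real_distribution_def real_distribution_axioms_def prob_space_normal_density)
  have rd': "real_distribution iE" "real_distribution iS" "real_distribution pG" "real_distribution q"
    "real_distribution aX" "real_distribution sE"
    unfolding iE_def iS_def pG_def q_def aX_def sE_def
    by (intro real_distribution_distr_real rS rE rZ rG rN; simp)+
  have self: "distr \<mu> borel (\<lambda>x. x) = \<mu>" if "real_distribution \<mu>" for \<mu>
    using that by (intro distr_id2) (simp add: real_distribution_sets)
  have invinv: "distr (distr \<mu> borel inverse) borel inverse = \<mu>" if "real_distribution \<mu>" for \<mu> :: "real measure"
    using that self[OF that] by (simp add: distr_distr comp_def real_distribution_sets cong: measurable_cong_sets)

  have W: "weibull_law \<gamma> = E \<odot> iS"
    unfolding E_def iS_def using assms(6,3,4) by (rule weibull_law_eq_exponential_quotient)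
  \<comment> \<open>The reciprocal of W_1 / S is S / W_1: this yields the first representation of M
    and supplies the numerator of R.\<close>
  have iW: "distr (weibull_law \<gamma>) borel inverse = iE \<odot> \<sigma>"
    unfolding W using rS rE rd' by (subst distr_mult_convolution_hom) (simp_all add: iE_def iS_def invinv)
  have R: "ratio_law \<sigma> = \<sigma> \<odot> iS"
    using distr_pair_mult[OF rS rS, of "\<lambda>x. x" inverse] by (simp add: ratio_law_def iS_def self rS divide_inverse)
  have P: "pareto_law = E \<odot> iE"
    unfolding E_def iE_def by (rule pareto_law_eq_exponential_quotient)
  have XE: "aX \<odot> sE = E"
    unfolding aX_def sE_def E_def by (rule exponential_eq_normal_product)
  \<comment> \<open>Taking the power 1/\<gamma> in G = W_1 / Z gives W_1^(1/\<gamma>)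
    Z^(-1/\<gamma>), and W_1^(1/\<gamma>) is Weibull of shape \<gamma>, hence again W_1 / S.\<close>
  have "pG = distr (E \<odot> distr (Z_law r l) borel inverse) borel (\<lambda>x. x powr (1 / \<gamma>))"
    unfolding pG_def E_def using gamma_law_eq_exponential_quotient[OF assms(1,2,5)] by simp
  also have "\<dots> = distr E borel (\<lambda>x. x powr (1 / \<gamma>)) \<odot> distr (distr (Z_law r l) borel inverse) borel (\<lambda>x. x powr (1 / \<gamma>))"
    by (intro distr_mult_convolution_hom rE real_distribution_distr_real rZ) (simp_all add: powr_mult)
  also have "distr (distr (Z_law r l) borel inverse) borel (\<lambda>x. x powr (1 / \<gamma>)) = q"
  proof -
    have "inverse z powr (1 / \<gamma>) = inverse (z powr (1 / \<gamma>))" for z :: real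
      by (simp add: powr_def ln_inverse exp_minus)
    then show ?thesis
      unfolding q_def using rZ by (subst distr_distr) (simp_all add: comp_def real_distribution_sets cong: measurable_cong_sets)
  qed
  also have "distr E borel (\<lambda>x. x powr (1 / \<gamma>)) = E \<odot> iS"
    unfolding E_def using assms(3) by (simp add: distr_weibull_law_powr W[unfolded E_def])
  finally have pG: "pG = (E \<odot> iS) \<odot> q" .
  have M: "M_law r \<gamma> l = pG \<odot> (iE \<odot> \<sigma>)"
    unfolding iW[symmetric] pG_def
    using distr_pair_mult[OF rG rW, of "\<lambda>x. x powr (1 / \<gamma>)" inverse] by (simp add: M_law_def divide_inverse)

  have D1: "distr \<Omega>1 borel (\<lambda>\<omega>. G1 \<omega> powr (1 / \<gamma>) * S1 \<omega> / W1 \<omega>) = pG \<odot> (\<sigma> \<odot> iE)"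
    using distr_prod_independent_compose[OF assms(7), of "[\<lambda>x. x powr (1 / \<gamma>), \<lambda>x. x, inverse]"] rS rE rd'
    by (auto simp: self mult_convolution_return divide_inverse mult.assoc E_def pG_def iE_def)
  have D2: "distr \<Omega>2 borel (\<lambda>\<omega>. W2 \<omega> / W2' \<omega> * (1 / Z2 \<omega> powr (1 / \<gamma>))) = (E \<odot> iS) \<odot> ((iE \<odot> \<sigma>) \<odot> q)"
    using distr_prod_independent_compose[OF assms(8), of "[\<lambda>x. x, inverse, \<lambda>z. inverse (z powr (1 / \<gamma>))]"] rW rd'
    by (auto simp: self mult_convolution_return divide_inverse mult.assoc q_def iW[symmetric] W[symmetric])
  have D3: "distr \<Omega>3 borel (\<lambda>\<omega>. W3 \<omega> * (R3 \<omega> / (W3' \<omega> * Z3 \<omega> powr (1 / \<gamma>)))) = E \<odot> ((\<sigma> \<odot> iS) \<odot> (iE \<odot> q))"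
    using distr_prod_independent_compose[OF assms(9), of "[\<lambda>x. x, \<lambda>x. x, inverse, \<lambda>z. inverse (z powr (1 / \<gamma>))]"] rS rE rd'
    by (auto simp: self mult_convolution_return real_distribution_mult_convolution divide_inverse mult.assoc q_def iE_def E_def R)
  have D4: "distr \<Omega>4 borel (\<lambda>\<omega>. P4 \<omega> * R4 \<omega> / Z4 \<omega> powr (1 / \<gamma>)) = (E \<odot> iE) \<odot> ((\<sigma> \<odot> iS) \<odot> q)"
    using distr_prod_independent_compose[OF assms(10), of "[\<lambda>x. x, \<lambda>x. x, \<lambda>z. inverse (z powr (1 / \<gamma>))]"] rS rE rd'
    by (auto simp: self mult_convolution_return real_distribution_mult_convolution divide_inverse mult.assoc q_def P R)
  have D5: "distr \<Omega>5 borel (\<lambda>\<omega>. \<bar>X5 \<omega>\<bar> * sqrt (2 * W5 \<omega>) * R5 \<omega> / (W5' \<omega> * Z5 \<omega> powr (1 / \<gamma>)))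
      = aX \<odot> (sE \<odot> ((\<sigma> \<odot> iS) \<odot> (iE \<odot> q)))"
    using distr_prod_independent_compose[OF assms(11), of "[abs, \<lambda>w. sqrt (2 * w), \<lambda>x. x, inverse, \<lambda>z. inverse (z powr (1 / \<gamma>))]"] rS rE rd'
    by (auto simp: self mult_convolution_return real_distribution_mult_convolution divide_inverse mult.assoc q_def iE_def E_def R aX_def sE_def)
  have X5: "aX \<odot> (sE \<odot> \<mu>) = E \<odot> \<mu>" if "real_distribution \<mu>" for \<mu>
    using that rd' by (simp add: XE flip: mult_convolution_assoc)
  note rmc = real_distribution_mult_convolution and assoc = mult_convolution_assoc and comm = mult_convolution_commute
  \<comment> \<open>Commutativity and associativity of \<odot> are conditional on
    \<open>real_distribution\<close>, so the rearrangements use explicit instances.\<close>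
  have E12: "((E \<odot> iS) \<odot> q) \<odot> (iE \<odot> \<sigma>) = (E \<odot> iS) \<odot> ((iE \<odot> \<sigma>) \<odot> q)"
    using assoc[OF rmc[OF rE rd'(2)] rd'(4) rmc[OF rd'(1) rS]] comm[OF rd'(4) rmc[OF rd'(1) rS]] by simp
  have "(E \<odot> iS) \<odot> ((iE \<odot> \<sigma>) \<odot> q) = (E \<odot> iS) \<odot> (\<sigma> \<odot> (iE \<odot> q))"
    using assoc[OF rS rd'(1) rd'(4)] comm[OF rd'(1) rS] by simp
  also have "\<dots> = E \<odot> (iS \<odot> (\<sigma> \<odot> (iE \<odot> q)))"
    by (intro assoc rE rd' rmc rS)
  also have "iS \<odot> (\<sigma> \<odot> (iE \<odot> q)) = (\<sigma> \<odot> iS) \<odot> (iE \<odot> q)"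
    using assoc[OF rd'(2) rS rmc[OF rd'(1) rd'(4)]] comm[OF rd'(2) rS] by simp
  finally have E23: "(E \<odot> iS) \<odot> ((iE \<odot> \<sigma>) \<odot> q) = E \<odot> ((\<sigma> \<odot> iS) \<odot> (iE \<odot> q))" .
  have E34: "E \<odot> ((\<sigma> \<odot> iS) \<odot> (iE \<odot> q)) = (E \<odot> iE) \<odot> ((\<sigma> \<odot> iS) \<odot> q)"
    using assoc[OF rE rd'(1) rmc[OF rmc[OF rS rd'(2)] rd'(4)]]
      mult_convolution_left_commute[OF rd'(1) rmc[OF rS rd'(2)] rd'(4)] by simp
  have E45: "aX \<odot> (sE \<odot> ((\<sigma> \<odot> iS) \<odot> (iE \<odot> q))) = E \<odot> ((\<sigma> \<odot> iS) \<odot> (iE \<odot> q))"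
    by (intro X5 rmc rS rd')
  show ?thesis
    unfolding D1 D2 D3 D4 D5 M comm[OF rd'(1) rS, symmetric]
    using pG E12 E23 E34 E45 comm[OF rd'(1) rS] by simp
qed

end
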